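(* Let $d\ge1$, $K=K_0=[-1,1]^d$, and run the diminishing process with uniform points. Then $K_n$ is an axis-parallel box; let $m_1(n),\dots,m_d(n)$ be its edge lengths, $m_n=\max_i m_i(n)$, and $(Z_1(n),\dots,Z_d(n))$ its center. Then \[ 2n\big(m_1(n)-1,\dots,m_d(n)-1\big)\xrightarrow{\mathcal D}(W_1,\dots,W_d), \] where $W_1,\dots,W_d$ are independent exponential random variables with parameter $1$; \[ 2n(m_n-1)\xrightarrow{\mathcal D}W,\qquad \mathbb P\{W\le x\}=(1-e^{-x})^d,\ x\ge0; \] and \[ (Z_1(n),\dots,Z_d(n))\xrightarrow{\mathcal D}(Z_1,\dots,Z_d), \] where $Z_1,\dots,Z_d$ are independent with density $\dfrac{1}{\pi\sqrt{(1/2+x)(1/2-x)}}$, $x\in(-1/2,1/2)$.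
   Context: Diminishing process: given convex bodies $K,K_0\subset\mathbb R^d$ with $0\in K$, for $n\ge0$ let $p_{n+1}$ be a point chosen uniformly at random from $K_n$ (conditionally on $p_1,\dots,p_n$), and set $K_{n+1}=K_n\cap(p_{n+1}+K)$. *)

theory Defs
  imports "HOL-Probability.Probability"
begin

text \<open>The diminishing process. A run is recorded by the points p_1, p_2, ...;
  the function ps :: nat => 'a stores p_(i+1) at index i. The body after n steps is
  K_n = K_0 \<inter> (p_1 + K) \<inter> ... \<inter> (p_n + K).\<close>

definition dim_body :: "'a::euclidean_space set \<Rightarrow> 'a set \<Rightarrow> nat \<Rightarrow> (nat \<Rightarrow> 'a) \<Rightarrow> 'a set" where
  "dim_body K K0 n ps = K0 \<inter> (\<Inter>i<n. (\<lambda>k. ps i + k) ` K)"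

fun dim_law :: "'a::euclidean_space set \<Rightarrow> 'a set \<Rightarrow> nat \<Rightarrow> (nat \<Rightarrow> 'a) measure" where
  "dim_law K K0 0 = PiM {} (\<lambda>_. lborel)"
| "dim_law K K0 (Suc n) =
     dim_law K K0 n \<bind>
       (\<lambda>ps. distr (uniform_measure lborel (dim_body K K0 n ps))
                   (PiM {..<Suc n} (\<lambda>_. lborel)) (\<lambda>p. ps(n := p)))"

definition cube :: "(real^'d) set" where
  "cube = {x. \<forall>i. \<bar>x $ i\<bar> \<le> 1}"

definition edge_len :: "(real^'d) set \<Rightarrow> 'd \<Rightarrow> real" where
  "edge_len S i = Sup ((\<lambda>x. x $ i) ` S) - Inf ((\<lambda>x. x $ i) ` S)"

definition centre_coord :: "(real^'d) set \<Rightarrow> 'd \<Rightarrow> real" where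
  "centre_coord S i = (Sup ((\<lambda>x. x $ i) ` S) + Inf ((\<lambda>x. x $ i) ` S)) / 2"

definition conv_distr :: "(nat \<Rightarrow> 'a::metric_space measure) \<Rightarrow> 'a measure \<Rightarrow> bool" where
  "conv_distr Ms M \<longleftrightarrow>
     (\<forall>f::'a \<Rightarrow> real. continuous_on UNIV f \<longrightarrow> bounded (range f) \<longrightarrow>
        (\<lambda>n. \<integral>x. f x \<partial>Ms n) \<longlonglongrightarrow> (\<integral>x. f x \<partial>M))"

definition arcsine_half_density :: "real \<Rightarrow> real" where
  "arcsine_half_density x =
     (if -1/2 < x \<and> x < 1/2 then 1 / (pi * sqrt ((1/2 + x) * (1/2 - x))) else 0)"

end

theory Submission
  imports Defs
begin

text \<open>
  The uniform distribution on a box is the product of the uniform distributions on its edges, so the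
  coordinates of the process are independent copies of the one-dimensional process of intervals
  $[a,b]$, whose excess length $x=b-a-1$ lies in $[0,1]$. In one dimension
  $P(x_{n+1}>t)=E[(1-2t/(1+x_n));\,x_n>t]$, and since $x_n\to0$ this is squeezed between
  $(1-2t)P(x_n>t)$ and, up to a summable error, $(1-2t/(1+\varepsilon))P(x_n>t)$; with $t=s/(2n)$
  this gives the exponential limit. For the centre, the arcsine distribution function scaled to the
  interval $[a+1/2,b-1/2]$ of possible limits is harmonic for the chain, so its expectation is
  constant in $n$, while it approaches the indicator of the event that the centre is at most $t$.
  Skorohod's representation in each coordinate lifts weak convergence to the product laws.
\<close>

section \<open>One step of the process\<close>

text \<open>The factor 2 comes from the two ends: the next excess is above t exactly when the
  current one is and the new point keeps distance more than t from both ends. The recursion for the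
  tails is not closed, because the random length 1 + x stands in a denominator; hence only bounds
  are iterated. The arcsine law comes from a fixed-point equation. The limiting interval has length
  one, so its centre ranges over an interval of length x. A cut that changes [a,b] replaces x by
  some s uniform on [0,x] and keeps the left or the right end with equal chance. The limiting centre
  Y, normalised to [0,1], thus has the law of U Y' or of 1 - U + U Y', each with probability 1/2,
  where U is uniform and Y' an independent copy of Y. This is the stick-breaking identity of the
  Beta(1/2,1/2) law. For distribution functions it comes down to one elementary integral. Some point
  sequences have an empty body, so length at least one holds only almost surely, while the body is a
  box for every sequence.\<close>

lemma measurable_uniform_measure_sections:
  assumes A: "{z \<in> space (M \<Otimes>\<^sub>M N). snd z \<in> A (fst z)} \<in> sets (M \<Otimes>\<^sub>M N)"
    and N: "sigma_finite_measure N" and ne: "space N \<noteq> {}"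
    and sub: "\<And>x. x \<in> space M \<Longrightarrow> A x \<in> sets N"
  shows "(\<lambda>x. uniform_measure N (A x)) \<in> M \<rightarrow>\<^sub>M subprob_algebra N"
proof -
  interpret N: sigma_finite_measure N by fact
  have meas: "(\<lambda>x. emeasure N (A x \<inter> B)) \<in> borel_measurable M" if B: "B \<in> sets N" for B
  proof -
    have C: "{z \<in> space (M \<Otimes>\<^sub>M N). snd z \<in> A (fst z)} \<inter> (space M \<times> B) \<in> sets (M \<Otimes>\<^sub>M N)"
      using A B by auto
    have "(\<lambda>x. emeasure N (Pair x -` ({z \<in> space (M \<Otimes>\<^sub>M N). snd z \<in> A (fst z)} \<inter> (space M \<times> B))))
        \<in> borel_measurable M"
      by (rule N.measurable_emeasure_Pair[OF C])
    also have "?this \<longleftrightarrow> ?thesis"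
      using sub[THEN sets.sets_into_space] sets.sets_into_space[OF B]
      by (intro measurable_cong arg_cong2[where f=emeasure] refl) (auto simp: space_pair_measure)
    finally show ?thesis .
  qed
  have eq: "A x \<inter> space N = A x" if "x \<in> space M" for x
    using sub[OF that, THEN sets.sets_into_space] by auto
  show ?thesis
  proof (rule measurable_subprob_algebra)
    fix x assume x: "x \<in> space M"
    show "subprob_space (uniform_measure N (A x))"
    proof (rule subprob_spaceI)
      have "emeasure (uniform_measure N (A x)) (space N) = emeasure N (A x) / emeasure N (A x)"
        using x sub eq by simp
      \<comment> \<open>The quotient is 1 unless the measure of \<open>A x\<close> is zero or
        infinite; there division in ennreal gives 0, so the kernel is only a sub-probability
        kernel.\<close>
      also have "\<dots> \<le> 1" by (cases "emeasure N (A x) = 0") (simp_all add: divide_le_posI_ennreal zero_less_iff_neq_zero)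
      finally show "emeasure (uniform_measure N (A x)) (space (uniform_measure N (A x))) \<le> 1" by simp
      show "space (uniform_measure N (A x)) \<noteq> {}" using ne by simp
    qed
    show "sets (uniform_measure N (A x)) = sets N" by simp
  next
    fix B assume B: "B \<in> sets N"
    have "(\<lambda>x. emeasure N (A x \<inter> B) / emeasure N (A x \<inter> space N)) \<in> borel_measurable M"
      using meas[OF B] meas[OF sets.top] by measurable
    also have "?this \<longleftrightarrow> (\<lambda>x. emeasure (uniform_measure N (A x)) B) \<in> borel_measurable M"
      by (intro measurable_cong) (simp add: eq sub B)
    finally show "(\<lambda>x. emeasure (uniform_measure N (A x)) B) \<in> borel_measurable M" .
  qed
qed

lemma translate_image: "(\<lambda>k. p + k) ` K = {x. x - p \<in> (K :: 'a::euclidean_space set)}"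
  by (auto simp: image_iff algebra_simps intro!: bexI[of _ "_ - p"])

lemma dim_body_borel:
  assumes "K \<in> sets borel" "K0 \<in> sets borel"
  shows "dim_body K K0 n ps \<in> sets borel"
proof -
  have "{x. x - p \<in> K} \<in> sets borel" for p
    using assms(1) by measurable
  then have "(\<lambda>k. p + k) ` K \<in> sets borel" for p by (simp only: translate_image)
  then show ?thesis
    unfolding dim_body_def using assms(2)
    by (cases "n = 0") (auto intro!: sets.Int sets.finite_INT)
qed

lemma sets_dim_law [simp, measurable_cong]:
  "sets (dim_law K K0 n) = sets (PiM {..<n} (\<lambda>_. lborel))"
proof (cases n)
  case (Suc m)
  \<comment> \<open>\<open>bind\<close> over a measure with empty space is the count space of the
    empty set, so the sigma algebra is the intended one only once nonemptiness is known.\<close>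
  have "space (dim_law K K0 m) \<noteq> {}" for m
  proof (induction m)
    case (Suc m)
    show ?case
      by (simp add: space_bind[where N="PiM {..<Suc m} (\<lambda>_. lborel)"] Suc space_PiM PiE_eq_empty_iff)
  qed (simp add: space_PiM)
  then show ?thesis using Suc by (simp add: sets_bind)
qed simp

lemma space_dim_law [simp]: "space (dim_law K K0 n) = {..<n} \<rightarrow>\<^sub>E UNIV"
  using sets_eq_imp_space_eq[OF sets_dim_law] by (simp add: space_PiM)

text \<open>The recursions for the end points and for the cube both rest on this formula. Unfolding
  \<open>bind\<close> requires a kernel that is measurable in the past \<open>ps\<close>; it is,
  because the graph of the body is cut out by finitely many measurable conditions
  \<open>snd z - fst z i \<in> K\<close>.\<close>

lemma nn_integral_dim_law_Suc:
  fixes K K0 :: "'a::euclidean_space set"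
  assumes K [measurable]: "K \<in> sets borel" and K0 [measurable]: "K0 \<in> sets borel"
    and f: "f \<in> borel_measurable (PiM {..<Suc n} (\<lambda>_. lborel))"
  shows "(\<integral>\<^sup>+ps. f ps \<partial>dim_law K K0 (Suc n)) =
    (\<integral>\<^sup>+ps. \<integral>\<^sup>+p. f (ps(n := p)) \<partial>uniform_measure lborel (dim_body K K0 n ps) \<partial>dim_law K K0 n)"
proof -
  let ?P = "\<lambda>n. PiM {..<n} (\<lambda>_. lborel) :: (nat \<Rightarrow> 'a) measure"
  have upd: "case_prod (\<lambda>ps p. ps(n := p)) \<in> ?P n \<Otimes>\<^sub>M lborel \<rightarrow>\<^sub>M ?P (Suc n)"
    using measurable_add_dim[of n "{..<n}" "\<lambda>_. lborel :: 'a measure"] by (simp add: lessThan_Suc)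
  have kernel: "(\<lambda>ps. uniform_measure lborel (dim_body K K0 n ps)) \<in> ?P n \<rightarrow>\<^sub>M subprob_algebra lborel"
  proof (rule measurable_uniform_measure_sections)
    have [measurable]: "(\<lambda>z. snd z - fst z i) \<in> ?P n \<Otimes>\<^sub>M lborel \<rightarrow>\<^sub>M borel" if "i \<in> {..<n}" for i
      using that by measurable
    have "{z \<in> space (?P n \<Otimes>\<^sub>M lborel). snd z \<in> K0 \<and> (\<forall>i\<in>{..<n}. snd z - fst z i \<in> K)}
        \<in> sets (?P n \<Otimes>\<^sub>M lborel)"
      by measurable
    also have "{z \<in> space (?P n \<Otimes>\<^sub>M lborel). snd z \<in> K0 \<and> (\<forall>i\<in>{..<n}. snd z - fst z i \<in> K)} =
        {z \<in> space (?P n \<Otimes>\<^sub>M lborel). snd z \<in> dim_body K K0 n (fst z)}"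
      by (auto simp: dim_body_def translate_image)
    finally show "\<dots> \<in> sets (?P n \<Otimes>\<^sub>M lborel)" .
  qed (auto simp: lborel.sigma_finite_measure_axioms dim_body_borel K K0)
  have step: "(\<lambda>ps. distr (uniform_measure lborel (dim_body K K0 n ps)) (?P (Suc n)) (\<lambda>p. ps(n := p)))
      \<in> ?P n \<rightarrow>\<^sub>M subprob_algebra (?P (Suc n))"
    by (rule measurable_distr2[OF upd kernel])
  have "(\<integral>\<^sup>+ps. f ps \<partial>dim_law K K0 (Suc n)) = (\<integral>\<^sup>+ps. \<integral>\<^sup>+q. f q
     \<partial>distr (uniform_measure lborel (dim_body K K0 n ps)) (?P (Suc n)) (\<lambda>p. ps(n := p)) \<partial>dim_law K K0 n)"
    unfolding dim_law.simps
    by (rule nn_integral_bind[where B="?P (Suc n)"]) (use f step in \<open>simp_all cong: measurable_cong_sets\<close>)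
  also have "\<dots> = (\<integral>\<^sup>+ps. \<integral>\<^sup>+p. f (ps(n := p)) \<partial>uniform_measure lborel (dim_body K K0 n ps) \<partial>dim_law K K0 n)"
  proof (rule nn_integral_cong)
    fix ps assume "ps \<in> space (dim_law K K0 n)"
    then have ps: "ps \<in> space (?P n)" by (simp add: space_PiM)
    have "(\<lambda>p. ps(n := p)) \<in> lborel \<rightarrow>\<^sub>M ?P (Suc n)"
      using measurable_Pair2[OF upd ps] by simp
    then show "(\<integral>\<^sup>+q. f q \<partial>distr (uniform_measure lborel (dim_body K K0 n ps)) (?P (Suc n)) (\<lambda>p. ps(n := p)))
      = (\<integral>\<^sup>+p. f (ps(n := p)) \<partial>uniform_measure lborel (dim_body K K0 n ps))"
      by (intro nn_integral_distr) (use f in \<open>simp_all cong: measurable_cong_sets\<close>)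
  qed
  finally show ?thesis .
qed

section \<open>Reduction to intervals\<close>

text \<open>The recursion does not ask whether the interval is still nonempty: once
  \<open>lower_end\<close> exceeds \<open>upper_end\<close>, the interval and the body are both
  empty. The descriptions of the body below therefore hold for all sequences.\<close>

primrec lower_end :: "nat \<Rightarrow> (nat \<Rightarrow> real) \<Rightarrow> real" where
  "lower_end 0 q = -1"
| "lower_end (Suc n) q = max (lower_end n q) (q n - 1)"

primrec upper_end :: "nat \<Rightarrow> (nat \<Rightarrow> real) \<Rightarrow> real" where
  "upper_end 0 q = 1"
| "upper_end (Suc n) q = min (upper_end n q) (q n + 1)"

lemma dim_body_Suc: "dim_body K K0 (Suc n) ps = dim_body K K0 n ps \<inter> (\<lambda>k. ps n + k) ` K"
  by (auto simp: dim_body_def lessThan_Suc)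

lemma dim_body_interval: "dim_body {-1..1} {-1..1} n q = {lower_end n q..upper_end n q}"
proof (induction n)
  case 0
  then show ?case by (simp add: dim_body_def)
next
  case (Suc n)
  show ?case by (simp add: dim_body_Suc Suc add.commute)
qed

lemma dim_body_cube:
  "dim_body (cube :: (real^'d) set) cube n ps =
    cbox (\<chi> i. lower_end n (\<lambda>j. ps j $ i)) (\<chi> i. upper_end n (\<lambda>j. ps j $ i))"
proof (induction n)
  case 0
  show ?case
    by (rule set_eqI) (simp add: dim_body_def cube_def mem_box_cart abs_le_iff minus_le_iff conj_commute)
next
  case (Suc n)
  have mem_cube: "x \<in> cube \<longleftrightarrow> (\<forall>i. \<bar>x $ i\<bar> \<le> 1)" for x :: "real^'d" by (simp add: cube_def)
  have step: "(l \<le> y \<and> y \<le> u) \<and> \<bar>y - p\<bar> \<le> 1 \<longleftrightarrow> max l (p - 1) \<le> y \<and> y \<le> min u (p + 1)"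
    for l u y p :: real
    unfolding max.bounded_iff min.bounded_iff abs_le_iff by linarith
  show ?case
    by (rule set_eqI)
       (simp only: dim_body_Suc Suc translate_image mem_cube Int_iff mem_Collect_eq mem_box_cart
          vec_lambda_beta vector_minus_component step lower_end.simps upper_end.simps flip: all_conj_distrib)
qed

text \<open>Meant for \<open>q(n := p)\<close> in the one-step formula: entry \<open>n\<close> is
  not yet read by the ends after n steps.\<close>

lemma lower_end_cong: "(\<And>j. j < n \<Longrightarrow> q j = r j) \<Longrightarrow> lower_end n q = lower_end n r"
  by (induction n) auto

lemma upper_end_cong: "(\<And>j. j < n \<Longrightarrow> q j = r j) \<Longrightarrow> upper_end n q = upper_end n r"
  by (induction n) auto

lemma measurable_lower_end [measurable]:
  "(\<And>j. j < n \<Longrightarrow> (\<lambda>x. q x j) \<in> borel_measurable M) \<Longrightarrow> (\<lambda>x. lower_end n (q x)) \<in> borel_measurable M"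
  by (induction n) auto

lemma measurable_upper_end [measurable]:
  "(\<And>j. j < n \<Longrightarrow> (\<lambda>x. q x j) \<in> borel_measurable M) \<Longrightarrow> (\<lambda>x. upper_end n (q x)) \<in> borel_measurable M"
  by (induction n) auto

lemma borel_measurable_vec_nth [measurable]: "(\<lambda>x :: real^'d. x $ i) \<in> borel_measurable borel"
  by (intro borel_measurable_continuous_onI continuous_intros)

section \<open>Integrals of product functions over boxes\<close>

lemma nn_integral_lborel_vec:
  fixes f :: "'d::finite \<Rightarrow> real \<Rightarrow> ennreal"
  assumes f: "\<And>i. f i \<in> borel_measurable borel"
  shows "(\<integral>\<^sup>+x. (\<Prod>i\<in>UNIV. f i (x $ i)) \<partial>(lborel :: (real^'d) measure)) = (\<Prod>i\<in>UNIV. \<integral>\<^sup>+y. f i y \<partial>lborel)"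
proof -
  \<comment> \<open>\<open>e\<close> identifies the index type with \<open>Basis\<close>, the index
    set in the product formula for Lebesgue measure.\<close>
  define e where "e i = (axis i 1 :: real^'d)" for i
  have e: "inj e" "(Basis :: (real^'d) set) = range e"
    by (auto simp: inj_def e_def axis_eq_axis Basis_vec_def)
  have "(\<integral>\<^sup>+x. (\<Prod>b\<in>Basis. f (inv e b) (x \<bullet> b)) \<partial>(lborel :: (real^'d) measure))
      = (\<Prod>b\<in>(Basis :: (real^'d) set). \<integral>\<^sup>+y. f (inv e b) y \<partial>lborel)"
    by (rule nn_integral_lborel_prod) (use f in auto)
  then show ?thesis
    by (simp add: e prod.reindex) (simp add: e_def inner_axis)
qed

text \<open>Finiteness excludes a zero factor next to an infinite one: \<open>0 * top\<close> is 0
  with inverse \<open>top\<close>, while the product of the inverses is 0.\<close>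

lemma inverse_prod_ennreal:
  fixes g :: "'i \<Rightarrow> ennreal"
  assumes "finite A" "\<And>i. i \<in> A \<Longrightarrow> g i < top"
  shows "inverse (\<Prod>i\<in>A. g i) = (\<Prod>i\<in>A. inverse (g i))"
  using assms
proof (induction A)
  case (insert i A)
  have "(\<Prod>i\<in>A. g i) < top"
    using insert.hyps(1) insert.prems by (induction A) (auto simp: ennreal_mult_less_top)
  then show ?case using insert by (simp add: ennreal_inverse_mult)
qed simp

text \<open>The source of independence: the indicator and the volume of a box both factor over the
  coordinates. Empty boxes are included; there both sides are 0.\<close>

lemma nn_integral_uniform_cbox:
  fixes f :: "'d::finite \<Rightarrow> real \<Rightarrow> ennreal" and a b :: "real^'d"
  assumes f [measurable]: "\<And>i. f i \<in> borel_measurable borel"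
  shows "(\<integral>\<^sup>+x. (\<Prod>i\<in>UNIV. f i (x $ i)) \<partial>uniform_measure lborel (cbox a b)) =
    (\<Prod>i\<in>UNIV. \<integral>\<^sup>+y. f i y \<partial>uniform_measure lborel {a $ i..b $ i})"
proof -
  have ind: "indicator (cbox a b) x = (\<Prod>i\<in>UNIV. indicator {a $ i..b $ i} (x $ i) :: ennreal)" for x
    by (auto simp: indicator_def mem_box_cart Ball_def intro!: prod.neutral[symmetric])
  have vol: "emeasure lborel (cbox a b) = (\<Prod>i\<in>UNIV. emeasure lborel {a $ i..b $ i})"
    using nn_integral_lborel_vec[of "\<lambda>i. indicator {a $ i..b $ i}"]
    by (simp flip: ind)
  have "(\<integral>\<^sup>+x. (\<Prod>i\<in>UNIV. f i (x $ i)) \<partial>uniform_measure lborel (cbox a b)) =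
      (\<integral>\<^sup>+x. (\<Prod>i\<in>UNIV. f i (x $ i) * indicator {a $ i..b $ i} (x $ i)) \<partial>lborel) / emeasure lborel (cbox a b)"
    by (subst nn_integral_uniform_measure) (simp_all add: ind prod.distrib)
  also have "\<dots> = (\<Prod>i\<in>UNIV. \<integral>\<^sup>+y. f i y * indicator {a $ i..b $ i} y \<partial>lborel) / emeasure lborel (cbox a b)"
    by (subst nn_integral_lborel_vec[of "\<lambda>i y. f i y * indicator {a $ i..b $ i} y"]) simp_all
  also have "\<dots> = (\<Prod>i\<in>UNIV. (\<integral>\<^sup>+y. f i y * indicator {a $ i..b $ i} y \<partial>lborel) / emeasure lborel {a $ i..b $ i})"
    by (simp add: vol divide_ennreal_def prod.distrib inverse_prod_ennreal emeasure_lborel_Icc_eq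
          del: emeasure_lborel_Icc)
  also have "\<dots> = (\<Prod>i\<in>UNIV. \<integral>\<^sup>+y. f i y \<partial>uniform_measure lborel {a $ i..b $ i})"
    by (simp add: nn_integral_uniform_measure)
  finally show ?thesis .
qed

section \<open>The Markov chain of interval end points\<close>

abbreviation interval_law :: "nat \<Rightarrow> (nat \<Rightarrow> real) measure" where
  "interval_law \<equiv> dim_law {-1..1} {-1..1}"

definition ends_law :: "nat \<Rightarrow> (real \<times> real) measure" where
  "ends_law n = distr (interval_law n) borel (\<lambda>q. (lower_end n q, upper_end n q))"

lemma measurable_ends [measurable]:
  "(\<lambda>q. (lower_end n q, upper_end n q)) \<in> PiM {..<n} (\<lambda>_. lborel) \<rightarrow>\<^sub>M borel"
proof -
  have [measurable]: "(\<lambda>q. q j) \<in> PiM {..<n} (\<lambda>_. lborel) \<rightarrow>\<^sub>M borel" if "j < n" for j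
    using measurable_component_singleton[of j "{..<n}" "\<lambda>_. lborel :: real measure"] that by simp
  show ?thesis by (rule borel_measurable_Pair) measurable
qed

lemma sets_ends_law [simp, measurable_cong]: "sets (ends_law n) = sets borel"
  by (simp add: ends_law_def)

lemma space_ends_law [simp]: "space (ends_law n) = UNIV"
  by (simp add: ends_law_def)

lemma nn_integral_ends_law:
  assumes [measurable]: "f \<in> borel_measurable borel"
  shows "(\<integral>\<^sup>+e. f e \<partial>ends_law n) = (\<integral>\<^sup>+q. f (lower_end n q, upper_end n q) \<partial>interval_law n)"
  unfolding ends_law_def by (rule nn_integral_distr) (simp_all cong: measurable_cong_sets)

lemma nn_integral_ends_law_0:
  assumes [measurable]: "f \<in> borel_measurable borel"
  shows "(\<integral>\<^sup>+e. f e \<partial>ends_law 0) = f (-1, 1)"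
  by (simp add: nn_integral_ends_law PiM_empty nn_integral_count_space_finite)

definition next_ends :: "real \<times> real \<Rightarrow> real \<Rightarrow> real \<times> real" where
  "next_ends e p = (max (fst e) (p - 1), min (snd e) (p + 1))"

lemma measurable_next_ends [measurable]:
  "case_prod next_ends \<in> borel \<Otimes>\<^sub>M borel \<rightarrow>\<^sub>M borel"
  by (simp add: next_ends_def case_prod_beta' flip: borel_prod)

lemma measurable_next_ends1 [measurable]: "next_ends e \<in> borel \<rightarrow>\<^sub>M borel"
  using measurable_Pair2[OF measurable_next_ends, of e] by simp

lemma ends_upd:
  "(lower_end (Suc n) (q(n := p)), upper_end (Suc n) (q(n := p))) = next_ends (lower_end n q, upper_end n q) p"
  using lower_end_cong[of n "q(n := p)" q] upper_end_cong[of n "q(n := p)" q]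
  by (simp add: next_ends_def)

lemma measurable_uniform_interval:
  "(\<lambda>e :: real \<times> real. uniform_measure lborel {fst e..snd e}) \<in> borel \<rightarrow>\<^sub>M subprob_algebra lborel"
proof (rule measurable_uniform_measure_sections)
  have [measurable]: "(fst :: real \<times> real \<Rightarrow> real) \<in> borel_measurable borel"
    "(snd :: real \<times> real \<Rightarrow> real) \<in> borel_measurable borel"
    by (simp_all flip: borel_prod)
  have "{z :: (real \<times> real) \<times> real \<in> space (borel \<Otimes>\<^sub>M lborel). fst (fst z) \<le> snd z \<and> snd z \<le> snd (fst z)}
      \<in> sets (borel \<Otimes>\<^sub>M lborel)"
    by measurable
  then show "{z :: (real \<times> real) \<times> real \<in> space (borel \<Otimes>\<^sub>M lborel). snd z \<in> {fst (fst z)..snd (fst z)}}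
      \<in> sets (borel \<Otimes>\<^sub>M lborel)"
    by simp
qed (auto simp: lborel.sigma_finite_measure_axioms)

text \<open>The transition operator of the chain of end points, acting on nonnegative test
  functions.\<close>

definition ends_step :: "(real \<times> real \<Rightarrow> ennreal) \<Rightarrow> real \<times> real \<Rightarrow> ennreal" where
  "ends_step f e = (\<integral>\<^sup>+p. f (next_ends e p) \<partial>uniform_measure lborel {fst e..snd e})"

lemma measurable_ends_step [measurable]:
  assumes [measurable]: "f \<in> borel_measurable borel"
  shows "ends_step f \<in> borel_measurable borel"
  unfolding ends_step_def
  by (rule nn_integral_measurable_subprob_algebra2[OF _ measurable_uniform_interval]) measurable

lemma nn_integral_ends_law_Suc:
  assumes f [measurable]: "f \<in> borel_measurable borel"
  shows "(\<integral>\<^sup>+e. f e \<partial>ends_law (Suc n)) = (\<integral>\<^sup>+e. ends_step f e \<partial>ends_law n)"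
proof -
  have m: "(\<lambda>q. f (lower_end (Suc n) q, upper_end (Suc n) q)) \<in> borel_measurable (PiM {..<Suc n} (\<lambda>_. lborel))"
    using measurable_ends[of "Suc n"] by (rule measurable_compose) (rule f)
  show ?thesis
    unfolding nn_integral_ends_law[OF f] nn_integral_ends_law[OF measurable_ends_step[OF f]]
    by (subst nn_integral_dim_law_Suc[OF _ _ m])
       (simp_all only: ends_upd ends_step_def dim_body_interval fst_conv snd_conv atLeastAtMost_borel)
qed

lemma cube_borel [measurable]: "(cube :: (real^'d) set) \<in> sets borel"
proof -
  have "(cube :: (real^'d) set) = cbox (\<chi> i. -1) (\<chi> i. 1)"
    using dim_body_cube[of 0] by (simp add: dim_body_def)
  then show ?thesis by (metis borel_closed closed_cbox)
qed

text \<open>One step turns the product of the \<open>f i\<close> into the product of the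
  \<open>ends_step (f i)\<close>, so the induction must range over arbitrary factors. Product test
  functions determine the joint law; this is where the coordinates become independent copies of the
  interval chain.\<close>

lemma nn_integral_cube_law_prod:
  fixes f :: "'d::finite \<Rightarrow> real \<times> real \<Rightarrow> ennreal"
  assumes "\<And>i. f i \<in> borel_measurable borel"
  shows "(\<integral>\<^sup>+ps. (\<Prod>i\<in>UNIV. f i (lower_end n (\<lambda>j. ps j $ i), upper_end n (\<lambda>j. ps j $ i)))
        \<partial>dim_law (cube :: (real^'d) set) cube n) = (\<Prod>i\<in>UNIV. \<integral>\<^sup>+e. f i e \<partial>ends_law n)"
  using assms
proof (induction n arbitrary: f)
  case 0
  then show ?case by (simp add: PiM_empty nn_integral_count_space_finite nn_integral_ends_law_0)
next
  case (Suc n)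
  note f [measurable] = Suc.prems
  let ?L = "\<lambda>n (ps :: nat \<Rightarrow> real^'d) i. (lower_end n (\<lambda>j. ps j $ i), upper_end n (\<lambda>j. ps j $ i))"
  have coord [measurable]: "(\<lambda>ps :: nat \<Rightarrow> real^'d. ps j $ i) \<in> PiM {..<n} (\<lambda>_. lborel) \<rightarrow>\<^sub>M borel"
    if "j < n" for i :: 'd and j n
  proof -
    have p: "(\<lambda>ps. ps j :: real^'d) \<in> PiM {..<n} (\<lambda>_. lborel) \<rightarrow>\<^sub>M borel"
      using measurable_component_singleton[of j "{..<n}" "\<lambda>_. lborel :: (real^'d) measure"] that by simp
    show ?thesis using measurable_compose[OF p borel_measurable_vec_nth[of i]] by simp
  qed
  have L: "(\<lambda>ps. ?L n ps i) \<in> PiM {..<n} (\<lambda>_. lborel) \<rightarrow>\<^sub>M borel" for n i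
    by (rule borel_measurable_Pair) measurable
  have m: "(\<lambda>ps. \<Prod>i\<in>UNIV. f i (?L (Suc n) ps i)) \<in> borel_measurable (PiM {..<Suc n} (\<lambda>_. lborel))"
    using measurable_compose[OF L f] by (intro borel_measurable_prod_ennreal) simp
  have upd: "?L (Suc n) (ps(n := p)) i = next_ends (?L n ps i) (p $ i)" for ps p i
  proof -
    have "(\<lambda>j. (ps(n := p)) j $ i) = (\<lambda>j. ps j $ i)(n := p $ i)" by auto
    then show ?thesis by (simp only: ends_upd)
  qed
  have "(\<integral>\<^sup>+ps. (\<Prod>i\<in>UNIV. f i (?L (Suc n) ps i)) \<partial>dim_law cube cube (Suc n)) =
      (\<integral>\<^sup>+ps. \<integral>\<^sup>+p. (\<Prod>i\<in>UNIV. f i (next_ends (?L n ps i) (p $ i)))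
        \<partial>uniform_measure lborel (dim_body cube cube n ps) \<partial>dim_law cube cube n)"
    by (subst nn_integral_dim_law_Suc[OF _ _ m]) (simp_all only: cube_borel upd)
  also have "\<dots> = (\<integral>\<^sup>+ps. (\<Prod>i\<in>UNIV. ends_step (f i) (?L n ps i)) \<partial>dim_law cube cube n)"
    unfolding dim_body_cube
    by (subst nn_integral_uniform_cbox) (simp_all add: ends_step_def)
  also have "\<dots> = (\<Prod>i\<in>UNIV. \<integral>\<^sup>+e. ends_step (f i) e \<partial>ends_law n)"
    by (rule Suc.IH) measurable
  also have "\<dots> = (\<Prod>i\<in>UNIV. \<integral>\<^sup>+e. f i e \<partial>ends_law (Suc n))"
    by (simp add: nn_integral_ends_law_Suc)
  finally show ?case .
qed

section \<open>The excess length of the interval\<close>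

text \<open>The almost sure invariant of the chain. Staying inside [-1,1] limits the length to 2;
  then the points that cut off a piece on the right and those that cut off a piece on the left form
  sets that do not overlap.\<close>

definition admissible :: "real \<times> real \<Rightarrow> bool" where
  "admissible e \<longleftrightarrow> -1 \<le> fst e \<and> snd e \<le> 1 \<and> fst e + 1 \<le> snd e"

lemma borel_measurable_fst_real [measurable]: "(fst :: real \<times> real \<Rightarrow> real) \<in> borel_measurable borel"
  and borel_measurable_snd_real [measurable]: "(snd :: real \<times> real \<Rightarrow> real) \<in> borel_measurable borel"
  by (simp_all flip: borel_prod)

text \<open>With e = (a,b), the new length is the least of 2, p + 1 - a, b - p + 1 and b - a, each
  of which is at least 1.\<close>

lemma admissible_next_ends:
  "admissible e \<Longrightarrow> p \<in> {fst e..snd e} \<Longrightarrow> admissible (next_ends e p)"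
  by (auto simp: admissible_def next_ends_def)

lemma ends_step_admissible:
  assumes [measurable]: "f \<in> borel_measurable borel" and "admissible e"
  shows "ends_step f e =
    (\<integral>\<^sup>+p. f (next_ends e p) * indicator {fst e..snd e} p \<partial>lborel) / ennreal (snd e - fst e)"
  using assms(2) by (simp add: ends_step_def nn_integral_uniform_measure admissible_def)

lemma AE_ends_law_admissible: "AE e in ends_law n. admissible e"
proof -
  have [measurable]: "{e. \<not> admissible e} \<in> sets borel"
    unfolding admissible_def by measurable
  have "emeasure (ends_law n) {e. \<not> admissible e} = 0"
  proof (induction n)
    case 0
    have "emeasure (ends_law 0) {e. \<not> admissible e} = (\<integral>\<^sup>+e. indicator {e. \<not> admissible e} e \<partial>ends_law 0)"
      by simp
    also have "\<dots> = 0" by (subst nn_integral_ends_law_0) (auto simp: admissible_def)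
    finally show ?case .
  next
    case (Suc n)
    have ae: "AE e in ends_law n. admissible e"
      by (rule AE_I[OF _ Suc]) auto
    have "emeasure (ends_law (Suc n)) {e. \<not> admissible e} =
        (\<integral>\<^sup>+e. indicator {e. \<not> admissible e} e \<partial>ends_law (Suc n))"
      by simp
    also have "\<dots> = (\<integral>\<^sup>+e. ends_step (indicator {e. \<not> admissible e}) e \<partial>ends_law n)"
      by (rule nn_integral_ends_law_Suc) measurable
    also have "\<dots> = (\<integral>\<^sup>+e. 0 \<partial>ends_law n)"
    proof (rule nn_integral_cong_AE, use ae in eventually_elim)
      fix e assume e: "admissible e"
      have "(\<integral>\<^sup>+p. indicator {e. \<not> admissible e} (next_ends e p) * indicator {fst e..snd e} p \<partial>lborel)
          = (\<integral>\<^sup>+p. 0 \<partial>(lborel :: real measure))"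
        by (rule nn_integral_cong) (use admissible_next_ends[OF e] in \<open>auto simp: indicator_def\<close>)
      then show "ends_step (indicator {e. \<not> admissible e}) e = 0"
        by (subst ends_step_admissible[OF _ e]) simp_all
    qed
    finally show ?case by simp
  qed
  then show ?thesis by (intro AE_I[where N="{e. \<not> admissible e}"]) auto
qed

lemma prob_space_ends_law: "prob_space (ends_law n)"
proof (rule prob_spaceI, induction n)
  case 0
  show ?case using nn_integral_ends_law_0[of "\<lambda>_. 1"] by simp
next
  case (Suc n)
  have "emeasure (ends_law (Suc n)) (space (ends_law (Suc n))) = (\<integral>\<^sup>+e. 1 \<partial>ends_law (Suc n))" by simp
  also have "\<dots> = (\<integral>\<^sup>+e. ends_step (\<lambda>_. 1) e \<partial>ends_law n)"
    by (rule nn_integral_ends_law_Suc) measurable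
  also have "\<dots> = (\<integral>\<^sup>+e. 1 \<partial>ends_law n)"
  proof (rule nn_integral_cong_AE, use AE_ends_law_admissible in eventually_elim)
    fix e assume e: "admissible e"
    then show "ends_step (\<lambda>_. 1) e = 1"
      by (subst ends_step_admissible[OF _ e]) (auto simp: admissible_def divide_ennreal)
  qed
  also have "\<dots> = 1" using Suc by simp
  finally show ?case .
qed

text \<open>A bridge from the transition operator to gauge integrals, so that a step can be computed
  by splitting the interval and by the fundamental theorem of calculus. Nonnegativity of
  \<open>g\<close> is asked on admissible pairs only, since \<open>tail_step\<close> may be negative
  elsewhere.\<close>

lemma integral_ends_law_Suc:
  assumes f [measurable]: "f \<in> borel_measurable borel" and g [measurable]: "g \<in> borel_measurable borel"
    and f_nonneg: "\<And>e. 0 \<le> f e" and g_nonneg: "\<And>e. admissible e \<Longrightarrow> 0 \<le> g e"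
    and step: "\<And>e. admissible e \<Longrightarrow>
      ((\<lambda>p. f (next_ends e p)) has_integral (snd e - fst e) * g e) {fst e..snd e}"
  shows "(\<integral>e. f e \<partial>ends_law (Suc n)) = (\<integral>e. g e \<partial>ends_law n)"
proof -
  have "(\<integral>\<^sup>+e. ennreal (f e) \<partial>ends_law (Suc n)) = (\<integral>\<^sup>+e. ends_step (\<lambda>e. ennreal (f e)) e \<partial>ends_law n)"
    by (rule nn_integral_ends_law_Suc) measurable
  also have "\<dots> = (\<integral>\<^sup>+e. ennreal (g e) \<partial>ends_law n)"
  proof (rule nn_integral_cong_AE, use AE_ends_law_admissible in eventually_elim)
    fix e assume e: "admissible e"
    let ?h = "\<lambda>p. if p \<in> {fst e..snd e} then f (next_ends e p) else 0"
    have "(\<integral>\<^sup>+p. ennreal (f (next_ends e p)) * indicator {fst e..snd e} p \<partial>lborel) = (\<integral>\<^sup>+p. ennreal (?h p) \<partial>lborel)"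
      by (rule nn_integral_cong) (auto simp: indicator_def)
    also have "\<dots> = ennreal ((snd e - fst e) * g e)"
    proof (rule nn_integral_has_integral_lborel)
      have "{p. fst e \<le> p \<and> p \<le> snd e} \<in> sets borel" by simp
      then show "?h \<in> borel_measurable borel" by measurable
      show "(?h has_integral (snd e - fst e) * g e) UNIV"
        using step[OF e] by (simp add: has_integral_restrict_UNIV del: atLeastAtMost_iff)
    qed (simp add: f_nonneg)
    finally have *: "(\<integral>\<^sup>+p. ennreal (f (next_ends e p)) * indicator {fst e..snd e} p \<partial>lborel)
      = ennreal ((snd e - fst e) * g e)" .
    show "ends_step (\<lambda>e. ennreal (f e)) e = ennreal (g e)"
      using e g_nonneg[OF e]
      by (subst ends_step_admissible[OF _ e]) (auto simp: * admissible_def divide_ennreal)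
  qed
  finally have nn: "(\<integral>\<^sup>+e. ennreal (f e) \<partial>ends_law (Suc n)) = (\<integral>\<^sup>+e. ennreal (g e) \<partial>ends_law n)" .
  have "AE e in ends_law n. 0 \<le> g e"
    using AE_ends_law_admissible by eventually_elim (rule g_nonneg)
  then show ?thesis
    by (simp add: integral_eq_nn_integral f_nonneg nn)
qed

definition excess :: "real \<times> real \<Rightarrow> real" where
  "excess e = snd e - fst e - 1"

lemma measurable_excess [measurable]: "excess \<in> borel_measurable borel"
  unfolding excess_def by measurable

lemma excess_admissible: "admissible e \<Longrightarrow> excess e \<in> {0..1}"
  by (auto simp: admissible_def excess_def)

lemma integrable_ends_law:
  fixes f :: "real \<times> real \<Rightarrow> real"
  assumes "f \<in> borel_measurable borel" "\<And>e. admissible e \<Longrightarrow> \<bar>f e\<bar> \<le> B"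
  shows "integrable (ends_law n) f"
proof -
  interpret prob_space "ends_law n" by (rule prob_space_ends_law)
  show ?thesis
  proof (rule integrable_const_bound[of _ B])
    show "AE e in ends_law n. norm (f e) \<le> B"
      using AE_ends_law_admissible by eventually_elim (simp add: assms(2))
    show "f \<in> borel_measurable (ends_law n)"
      using assms(1) by (simp cong: measurable_cong_sets)
  qed
qed

lemma integral_ends_law_mono:
  fixes f g :: "real \<times> real \<Rightarrow> real"
  assumes "f \<in> borel_measurable borel" "\<And>e. admissible e \<Longrightarrow> \<bar>f e\<bar> \<le> B"
    and "g \<in> borel_measurable borel" "\<And>e. admissible e \<Longrightarrow> \<bar>g e\<bar> \<le> C"
    and "\<And>e. admissible e \<Longrightarrow> f e \<le> g e"
  shows "(\<integral>e. f e \<partial>ends_law n) \<le> (\<integral>e. g e \<partial>ends_law n)"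
proof (rule integral_mono_AE)
  show "AE e in ends_law n. f e \<le> g e"
    using AE_ends_law_admissible by eventually_elim (rule assms(5))
  show "integrable (ends_law n) f" "integrable (ends_law n) g"
    using integrable_ends_law[OF assms(1,2)] integrable_ends_law[OF assms(3,4)] by auto
qed

definition excess_tail :: "nat \<Rightarrow> real \<Rightarrow> real" where
  "excess_tail n t = measure (ends_law n) {e. t < excess e}"

text \<open>The conditional probability, given ends e, that the next excess is above t: if the
  current excess x is above t, the new point must avoid a piece of length t at each end of an
  interval of length 1 + x.\<close>

definition tail_step :: "real \<Rightarrow> real \<times> real \<Rightarrow> real" where
  "tail_step t e = indicator {e. t < excess e} e * (1 - 2 * t / (1 + excess e))"

lemma measurable_tail_step [measurable]: "tail_step t \<in> borel_measurable borel"
  unfolding tail_step_def by measurable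

lemma tail_step_bounds:
  assumes "admissible e" "0 \<le> t"
  shows "0 \<le> tail_step t e" "tail_step t e \<le> 1"
proof -
  have x: "0 \<le> excess e" "excess e \<le> 1" using excess_admissible[OF assms(1)] by auto
  have "2 * t / (1 + excess e) \<le> 1" if "t < excess e" using that x by simp
  then show "0 \<le> tail_step t e" by (simp add: tail_step_def indicator_def)
  show "tail_step t e \<le> 1" using assms(2) x by (simp add: tail_step_def indicator_def)
qed

lemma integral_tail_indicator: "(\<integral>e. indicator {e. t < excess e} e \<partial>ends_law n) = excess_tail n t"
  unfolding excess_tail_def by simp

lemma excess_tail_Suc:
  assumes "0 \<le> t"
  shows "excess_tail (Suc n) t = (\<integral>e. tail_step t e \<partial>ends_law n)"
  unfolding integral_tail_indicator[symmetric]
proof (rule integral_ends_law_Suc)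
  fix e assume e: "admissible e"
  show "((\<lambda>p. indicator {e. t < excess e} (next_ends e p)) has_integral (snd e - fst e) * tail_step t e) {fst e..snd e}"
  proof (cases "t < excess e")
    case True
    \<comment> \<open>A cut by a point near the left end leaves excess \<open>p - fst e\<close>, one
      by a point near the right end leaves \<open>snd e - p\<close>, and points in between change
      nothing; so exactly the points of \<open>?I\<close> keep the excess above t.\<close>
    let ?I = "{fst e + t<..<snd e - t}"
    have le: "fst e + t \<le> snd e - t"
      using True excess_admissible[OF e] by (simp add: excess_def)
    have "((\<lambda>_. 1 :: real) has_integral (snd e - t - (fst e + t))) {fst e + t..snd e - t}"
      using has_integral_const_real[of "1::real" "fst e + t" "snd e - t"] le by simp
    then have "((\<lambda>_. 1 :: real) has_integral (snd e - t - (fst e + t))) ?I"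
      using has_integral_open_interval[of "\<lambda>_. 1 :: real" _ "fst e + t" "snd e - t"] by (simp add: cbox_interval box_real)
    then have "((\<lambda>p. if p \<in> ?I then 1 else 0) has_integral (snd e - t - (fst e + t))) {fst e..snd e}"
      by (subst has_integral_restrict) (use assms in auto)
    also have "?this \<longleftrightarrow> ((\<lambda>p. indicator {e. t < excess e} (next_ends e p) :: real)
        has_integral (snd e - t - (fst e + t))) {fst e..snd e}"
    proof (rule has_integral_cong)
      fix p assume "p \<in> {fst e..snd e}"
      then show "(if p \<in> ?I then 1 else 0 :: real) = indicator {e. t < excess e} (next_ends e p)"
        using True e by (auto simp: indicator_def excess_def next_ends_def admissible_def max_def min_def)
    qed
    also have "snd e - t - (fst e + t) = (snd e - fst e) * tail_step t e"
      using True e by (simp add: tail_step_def excess_def admissible_def field_simps)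
    finally show ?thesis .
  next
    case False
    have "((\<lambda>p. indicator {e. t < excess e} (next_ends e p) :: real) has_integral 0) {fst e..snd e}"
      by (rule has_integral_is_0)
         (use False in \<open>auto simp: indicator_def excess_def next_ends_def max_def min_def split: if_splits\<close>)
    then show ?thesis using False by (simp add: tail_step_def)
  qed
qed (use assms tail_step_bounds in \<open>auto simp del: indicator_simps\<close>)

lemma excess_tail_bounds: "0 \<le> excess_tail n t" "excess_tail n t \<le> 1"
proof -
  interpret prob_space "ends_law n" by (rule prob_space_ends_law)
  show "0 \<le> excess_tail n t" "excess_tail n t \<le> 1" by (simp_all add: excess_tail_def)
qed

lemma excess_tail_0: "t < 1 \<Longrightarrow> excess_tail 0 t = 1"
  using nn_integral_ends_law_0[of "indicator {e. t < excess e}"]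
  by (simp add: excess_tail_def measure_def excess_def)

text \<open>The length is at least 1, so each step keeps at least the fraction 1 - 2t of the tail; t
  at most 1/2 makes this factor nonnegative.\<close>

lemma excess_tail_ge:
  assumes "0 \<le> t" "t \<le> 1 / 2"
  shows "(1 - 2 * t) ^ n \<le> excess_tail n t"
proof (induction n)
  case (Suc n)
  have "(1 - 2 * t) * (1 - 2 * t) ^ n \<le> (1 - 2 * t) * excess_tail n t"
    using Suc assms by (intro mult_left_mono) auto
  also have "\<dots> = (\<integral>e. (1 - 2 * t) * indicator {e. t < excess e} e \<partial>ends_law n)"
    by (simp add: excess_tail_def)
  also have "\<dots> \<le> (\<integral>e. tail_step t e \<partial>ends_law n)"
  proof (rule integral_ends_law_mono[where B=1 and C=1])
    fix e assume e: "admissible e"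
    have "2 * t / (1 + excess e) \<le> 2 * t / 1"
      using assms excess_admissible[OF e] by (intro divide_left_mono) auto
    then show "(1 - 2 * t) * indicator {e. t < excess e} e \<le> tail_step t e"
      by (simp add: tail_step_def indicator_def)
  qed (use assms tail_step_bounds in \<open>auto simp: indicator_def abs_le_iff intro: order_trans[of _ 0]\<close>)
  also have "\<dots> = excess_tail (Suc n) t" by (simp add: excess_tail_Suc assms)
  finally show ?case by simp
qed (use assms in \<open>simp add: excess_tail_0\<close>)

text \<open>A crude bound from length at most 2. At a fixed level it decays geometrically, which
  makes the errors in \<open>excess_tail_le\<close> summable.\<close>

lemma excess_tail_le_power:
  assumes "0 \<le> t" "t \<le> 1"
  shows "excess_tail n t \<le> (1 - t) ^ n"
proof (induction n)
  case (Suc n)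
  have "excess_tail (Suc n) t = (\<integral>e. tail_step t e \<partial>ends_law n)" by (simp add: excess_tail_Suc assms)
  also have "\<dots> \<le> (\<integral>e. (1 - t) * indicator {e. t < excess e} e \<partial>ends_law n)"
  proof (rule integral_ends_law_mono[where B=1 and C=1])
    fix e assume e: "admissible e"
    have "2 * t / 2 \<le> 2 * t / (1 + excess e)"
      using assms excess_admissible[OF e] by (intro divide_left_mono) auto
    then show "tail_step t e \<le> (1 - t) * indicator {e. t < excess e} e"
      by (simp add: tail_step_def indicator_def)
  qed (use assms tail_step_bounds in \<open>auto simp: indicator_def abs_le_iff intro: order_trans[of _ 0]\<close>)
  also have "\<dots> = (1 - t) * excess_tail n t" by (simp add: excess_tail_def)
  also have "\<dots> \<le> (1 - t) * (1 - t) ^ n"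
    using Suc assms by (intro mult_left_mono) auto
  finally show ?case by simp
qed (simp add: excess_tail_bounds)

text \<open>While the excess is at most \<epsilon>, the survival factor is at most 1 - 2t/(1 +
  \<epsilon>). Above \<epsilon> it can be larger, but by at most 2t, and the probabilities of these
  events are at most (1 - \<epsilon>)^k, with sum at most 1/\<epsilon>. For t = s/(2n) the error is
  s/(\<epsilon> n), which vanishes for fixed \<epsilon>.\<close>

lemma excess_tail_le:
  assumes "0 \<le> t" "t \<le> 1 / 2" "0 < \<epsilon>" "\<epsilon> < 1"
  shows "excess_tail n t \<le> (1 - 2 * t / (1 + \<epsilon>)) ^ n + 2 * t / \<epsilon>"
proof -
  let ?q = "1 - 2 * t / (1 + \<epsilon>)"
  have q: "0 \<le> ?q" "?q \<le> 1" using assms by (auto simp: divide_simps)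
  have int: "integrable (ends_law n) (indicator {e. t < excess e} :: _ \<Rightarrow> real)" for n t
    by (rule integrable_ends_law[where B=1]) (auto simp: indicator_def)
  \<comment> \<open>The induction carries the partial geometric sum; the factor \<open>?q\<close>
    that each step puts on earlier errors is bounded by 1.\<close>
  have "excess_tail n t \<le> ?q ^ n + 2 * t * (\<Sum>k<n. (1 - \<epsilon>) ^ k)"
  proof (induction n)
    case (Suc n)
    have "excess_tail (Suc n) t = (\<integral>e. tail_step t e \<partial>ends_law n)" by (simp add: excess_tail_Suc assms)
    also have "\<dots> \<le> (\<integral>e. ?q * indicator {e. t < excess e} e + 2 * t * indicator {e. \<epsilon> < excess e} e \<partial>ends_law n)"
    proof (rule integral_ends_law_mono[where B=1 and C=2])
      fix e assume e: "admissible e"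
      have x: "0 \<le> excess e" "excess e \<le> 1" using excess_admissible[OF e] by auto
      show "tail_step t e \<le> ?q * indicator {e. t < excess e} e + 2 * t * indicator {e. \<epsilon> < excess e} e"
      proof (cases "\<epsilon> < excess e")
        case True
        have "2 * t / (1 + \<epsilon>) \<le> 2 * t / 1" using assms by (intro divide_left_mono) auto
        moreover have "0 \<le> 2 * t / (1 + excess e)" using assms x by simp
        ultimately have "1 - 2 * t / (1 + excess e) \<le> ?q + 2 * t" by linarith
        then show ?thesis using True assms(1) by (simp add: tail_step_def indicator_def)
      next
        case False
        then have "2 * t / (1 + \<epsilon>) \<le> 2 * t / (1 + excess e)"
          using assms x by (intro divide_left_mono) auto
        then show ?thesis using False by (simp add: tail_step_def indicator_def)
      qed
      show "\<bar>?q * indicator {e. t < excess e} e + 2 * t * indicator {e. \<epsilon> < excess e} e\<bar> \<le> 2"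
        using assms(1,2) q by (auto simp: indicator_def)
    qed (use assms tail_step_bounds in \<open>auto simp: abs_le_iff intro: order_trans[of _ 0]\<close>)
    also have "\<dots> = ?q * excess_tail n t + 2 * t * excess_tail n \<epsilon>"
      using int by (simp add: excess_tail_def)
    also have "\<dots> \<le> ?q * (?q ^ n + 2 * t * (\<Sum>k<n. (1 - \<epsilon>) ^ k)) + 2 * t * (1 - \<epsilon>) ^ n"
      using Suc q assms excess_tail_le_power[of \<epsilon> n] by (intro add_mono mult_left_mono) auto
    also have "\<dots> = ?q ^ Suc n + ?q * (2 * t * (\<Sum>k<n. (1 - \<epsilon>) ^ k)) + 2 * t * (1 - \<epsilon>) ^ n"
      by (simp add: distrib_left)
    also have "?q * (2 * t * (\<Sum>k<n. (1 - \<epsilon>) ^ k)) \<le> 1 * (2 * t * (\<Sum>k<n. (1 - \<epsilon>) ^ k))"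
      using q assms by (intro mult_right_mono mult_nonneg_nonneg sum_nonneg) auto
    finally show ?case by (simp add: distrib_left)
  qed (simp add: excess_tail_bounds)
  also have "(\<Sum>k<n. (1 - \<epsilon>) ^ k) = (1 - (1 - \<epsilon>) ^ n) / \<epsilon>"
    using assms by (simp add: sum_gp_strict)
  also have "2 * t * ((1 - (1 - \<epsilon>) ^ n) / \<epsilon>) \<le> 2 * t / \<epsilon>"
    using assms by (auto simp: divide_simps intro!: mult_left_le)
  finally show ?thesis by simp
qed

lemma excess_tail_limit:
  assumes s: "0 \<le> s"
  shows "(\<lambda>n. excess_tail n (s / (2 * real n))) \<longlonglongrightarrow> exp (- s)"
proof (rule order_tendstoI)
  have small: "eventually (\<lambda>n. 0 < n \<and> s / (2 * real n) \<le> 1 / 2) sequentially"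
    using eventually_gt_at_top[of "nat \<lceil>s\<rceil>"]
  proof eventually_elim
    case (elim n)
    then have "s \<le> real n" "0 < n" using s by linarith+
    then show ?case by (simp add: divide_simps)
  qed
  fix y
  {
    assume "y < exp (- s)"
    moreover have "(\<lambda>n. (1 + (- s) / real n) ^ n) \<longlonglongrightarrow> exp (- s)"
      by (rule tendsto_exp_limit_sequentially)
    ultimately have "eventually (\<lambda>n. y < (1 + (- s) / real n) ^ n) sequentially"
      by (rule order_tendstoD(1)[rotated])
    with small show "eventually (\<lambda>n. y < excess_tail n (s / (2 * real n))) sequentially"
    proof eventually_elim
      case (elim n)
      then show ?case using excess_tail_ge[of "s / (2 * real n)" n] s by simp
    qed
  }
  assume y: "exp (- s) < y"
  \<comment> \<open>First \<epsilon> is fixed so small that the limit of the upper bound is still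
    below y; only then does n grow.\<close>
  have "((\<lambda>\<epsilon>. exp (- (s / (1 + \<epsilon>)))) \<longlongrightarrow> exp (- (s / (1 + 0)))) (at_right 0)"
    by (intro tendsto_intros) auto
  then have "eventually (\<lambda>\<epsilon>. exp (- (s / (1 + \<epsilon>))) < y) (at_right 0)"
    by (rule order_tendstoD(2)) (use y in simp)
  moreover have "eventually (\<lambda>\<epsilon>::real. \<epsilon> \<in> {0<..<1}) (at_right 0)"
    by (rule eventually_at_right_real) simp
  ultimately have "eventually (\<lambda>\<epsilon>. exp (- (s / (1 + \<epsilon>))) < y \<and> \<epsilon> \<in> {0<..<1}) (at_right (0 :: real))"
    by (rule eventually_conj)
  then have "\<exists>\<epsilon>. exp (- (s / (1 + \<epsilon>))) < y \<and> \<epsilon> \<in> {0<..<1}"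
    by (rule eventually_happens'[rotated]) simp
  then obtain \<epsilon> where \<epsilon>: "0 < \<epsilon>" "\<epsilon> < 1" "exp (- (s / (1 + \<epsilon>))) < y" by auto
  have "(\<lambda>n. (1 + (- (s / (1 + \<epsilon>))) / real n) ^ n + s / \<epsilon> / real n) \<longlonglongrightarrow> exp (- (s / (1 + \<epsilon>))) + 0"
    by (intro tendsto_add tendsto_exp_limit_sequentially lim_const_over_n)
  then have "eventually (\<lambda>n. (1 + (- (s / (1 + \<epsilon>))) / real n) ^ n + s / \<epsilon> / real n < y) sequentially"
    by (rule order_tendstoD(2)) (use \<epsilon> in simp)
  with small show "eventually (\<lambda>n. excess_tail n (s / (2 * real n)) < y) sequentially"
  proof eventually_elim
    case (elim n)
    have "2 * (s / (2 * real n)) / (1 + \<epsilon>) = s / (1 + \<epsilon>) / real n" "2 * (s / (2 * real n)) / \<epsilon> = s / \<epsilon> / real n"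
      by simp_all
    then show ?case using elim excess_tail_le[of "s / (2 * real n)" \<epsilon> n] s \<epsilon> by (simp add: mult.commute)
  qed
qed

section \<open>The arcsine law of the centre\<close>

text \<open>The distribution function of \<open>arcsine_half_density\<close>. Clamping the argument
  of \<open>arcsin\<close> to [-1,1] makes it continuous on the whole line, 0 to the left of the
  support and 1 to the right.\<close>

definition arcsine_cdf :: "real \<Rightarrow> real" where
  "arcsine_cdf y = 1 / 2 + arcsin (max (-1) (min 1 (2 * y))) / pi"

lemma continuous_arcsine_cdf: "continuous_on UNIV arcsine_cdf"
  unfolding arcsine_cdf_def by (intro continuous_intros) auto

lemma measurable_arcsine_cdf [measurable]: "arcsine_cdf \<in> borel_measurable borel"
  by (rule borel_measurable_continuous_onI[OF continuous_arcsine_cdf])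

lemma arcsine_cdf_eq_0: "y \<le> -1/2 \<Longrightarrow> arcsine_cdf y = 0"
  by (simp add: arcsine_cdf_def max.absorb1 min.absorb2)

lemma arcsine_cdf_eq_1: "1/2 \<le> y \<Longrightarrow> arcsine_cdf y = 1"
  by (simp add: arcsine_cdf_def max.absorb2 min.absorb1)

lemma arcsine_cdf_mid: "\<bar>y\<bar> \<le> 1/2 \<Longrightarrow> arcsine_cdf y = 1 / 2 + arcsin (2 * y) / pi"
  by (simp add: arcsine_cdf_def max.absorb2 min.absorb2 abs_le_iff)

lemma arcsine_cdf_minus: "arcsine_cdf (- y) = 1 - arcsine_cdf y"
proof -
  have "max (-1) (min 1 (2 * - y)) = - max (-1) (min 1 (2 * y))" by (simp add: max_def min_def)
  then show ?thesis
    unfolding arcsine_cdf_def by (simp add: arcsin_minus)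
qed

lemma arcsine_cdf_bounds: "0 \<le> arcsine_cdf y" "arcsine_cdf y \<le> 1"
proof -
  have "- (pi / 2) \<le> arcsin (max (-1) (min 1 (2 * y)))" "arcsin (max (-1) (min 1 (2 * y))) \<le> pi / 2"
    by (rule arcsin_lbound arcsin_ubound; simp)+
  then show "0 \<le> arcsine_cdf y" "arcsine_cdf y \<le> 1"
    by (simp_all add: arcsine_cdf_def divide_simps)
qed

lemma arcsine_cdf_integral_ge:
  assumes "0 < x" "x \<le> \<tau>"
  shows "((\<lambda>s. arcsine_cdf (\<tau> / s - 1/2)) has_integral x) {0..x}"
\<comment> \<open>At s = 0 division by zero makes the integrand 0 instead of 1.\<close>
proof (rule has_integral_spike_finite[of "{0}"])
  show "((\<lambda>_. 1 :: real) has_integral x) {0..x}"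
    using has_integral_const_real[of "1::real" 0 x] assms by simp
  fix s assume "s \<in> {0..x} - {0}"
  then show "arcsine_cdf (\<tau> / s - 1/2) = 1"
    using assms by (intro arcsine_cdf_eq_1) (auto simp: divide_simps)
qed simp

text \<open>Integration by parts: differentiating the \<open>arcsin\<close> behind the factor s
  gives -\<tau> / (pi R) with R = sqrt(\<tau> (s - \<tau>)), and the derivative of the square root
  term cancels it.\<close>

lemma arcsine_antiderivative:
  assumes \<tau>: "0 < \<tau>" and s: "\<tau> < s"
  shows "((\<lambda>s. s * (1 / 2 + arcsin (2 * \<tau> / s - 1) / pi) + 2 * sqrt (\<tau> * (s - \<tau>)) / pi)
    has_real_derivative 1 / 2 + arcsin (2 * \<tau> / s - 1) / pi) (at s)"
proof -
  define R where "R = sqrt (\<tau> * (s - \<tau>))"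
  have R: "R > 0" "R\<^sup>2 = \<tau> * (s - \<tau>)" using assms by (simp_all add: R_def)
  have "1 - (2 * \<tau> / s - 1)\<^sup>2 = 4 * (\<tau> * (s - \<tau>)) / s\<^sup>2"
    using assms by (simp add: field_simps power2_eq_square)
  also have "\<dots> = (2 * R / s)\<^sup>2"
    by (simp add: power_divide power_mult_distrib flip: R(2))
  finally have root: "sqrt (1 - (2 * \<tau> / s - 1)\<^sup>2) = 2 * R / s"
    using R(1) assms by (simp add: real_sqrt_abs)
  have v: "-1 < 2 * \<tau> / s - 1" "2 * \<tau> / s - 1 < 1"
    using assms by (simp_all add: divide_simps)
  have "((\<lambda>s. s * (1 / 2 + arcsin (2 * \<tau> / s - 1) / pi) + 2 * sqrt (\<tau> * (s - \<tau>)) / pi)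
    has_real_derivative (1 / 2 + arcsin (2 * \<tau> / s - 1) / pi)
      + s * (inverse (sqrt (1 - (2 * \<tau> / s - 1)\<^sup>2)) * (- (2 * \<tau> / s\<^sup>2)) / pi) + \<tau> * inverse R / pi) (at s)"
    using v assms R unfolding R_def
    by (auto intro!: derivative_eq_intros simp: power2_eq_square mult_less_0_iff)
  also have "s * (inverse (sqrt (1 - (2 * \<tau> / s - 1)\<^sup>2)) * (- (2 * \<tau> / s\<^sup>2)) / pi) =
    - (\<tau> * inverse R / pi)"
    unfolding root using R(1) assms by (simp add: divide_simps power2_eq_square)
  finally show ?thesis by simp
qed

text \<open>In \<open>limit_cdf_harmonic\<close>, s is the excess after a cut that keeps the left
  end, and \<tau> is the offset of t from the smallest possible limiting centre. The square root
  term is symmetric under exchanging \<tau> and x - \<tau>, so it cancels between cuts on the two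
  sides; \<open>max\<close> makes it vanish when t is outside the range of limiting centres.\<close>

lemma arcsine_cdf_integral:
  assumes x: "0 < x"
  shows "((\<lambda>s. arcsine_cdf (\<tau> / s - 1/2)) has_integral
    x * arcsine_cdf (\<tau> / x - 1/2) + 2 * sqrt (max 0 (\<tau> * (x - \<tau>))) / pi) {0..x}"
proof -
  consider "\<tau> \<le> 0" | "x \<le> \<tau>" | "0 < \<tau>" "\<tau> < x" by linarith
  then show ?thesis
  proof cases
    case 1
    have z: "arcsine_cdf (\<tau> / s - 1/2) = 0" if "0 \<le> s" for s
      using that 1 by (intro arcsine_cdf_eq_0) (simp add: divide_nonpos_nonneg)
    have "\<tau> * (x - \<tau>) \<le> 0" using 1 x by (simp add: mult_nonpos_nonneg)
    then show ?thesis
      using x by (intro has_integral_eq[OF _ has_integral_0, THEN has_integral_eq_rhs]) (auto simp: z)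
  next
    case 2
    have "arcsine_cdf (\<tau> / x - 1/2) = 1" using 2 x by (intro arcsine_cdf_eq_1) (simp add: divide_simps)
    moreover have "\<tau> * (x - \<tau>) \<le> 0" using 2 x by (simp add: mult_nonneg_nonpos)
    ultimately show ?thesis using arcsine_cdf_integral_ge[OF x 2] by simp
  next
    case 3
    let ?A = "\<lambda>s. s * (1 / 2 + arcsin (2 * \<tau> / s - 1) / pi) + 2 * sqrt (\<tau> * (s - \<tau>)) / pi"
    have \<Phi>: "arcsine_cdf (\<tau> / s - 1/2) = 1 / 2 + arcsin (2 * \<tau> / s - 1) / pi" if "\<tau> \<le> s" for s
    proof -
      have "\<bar>\<tau> / s - 1/2\<bar> \<le> 1/2" using that 3 by (simp add: abs_le_iff divide_simps)
      then show ?thesis by (simp add: arcsine_cdf_mid right_diff_distrib)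
    qed
    have "((\<lambda>s. 1 / 2 + arcsin (2 * \<tau> / s - 1) / pi) has_integral (?A x - ?A \<tau>)) {\<tau>..x}"
    \<comment> \<open>At s = \<tau> the square root has no derivative, but \<open>?A\<close> is
      continuous up to that point.\<close>
    proof (rule fundamental_theorem_of_calculus_interior)
      show "continuous_on {\<tau>..x} ?A"
        using 3 by (intro continuous_intros) (auto simp: divide_simps)
      show "(?A has_vector_derivative 1 / 2 + arcsin (2 * \<tau> / s - 1) / pi) (at s)" if "s \<in> {\<tau><..<x}" for s
        using arcsine_antiderivative[of \<tau> s] that 3
        by (simp add: has_real_derivative_iff_has_vector_derivative)
    qed (use 3 in simp)
    also have "?A x = x * arcsine_cdf (\<tau> / x - 1/2) + 2 * sqrt (max 0 (\<tau> * (x - \<tau>))) / pi"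
      using 3 by (simp add: \<Phi>)
    also have "?A \<tau> = \<tau>" using 3 by simp
    finally have upper: "((\<lambda>s. 1 / 2 + arcsin (2 * \<tau> / s - 1) / pi) has_integral
      (x * arcsine_cdf (\<tau> / x - 1/2) + 2 * sqrt (max 0 (\<tau> * (x - \<tau>))) / pi - \<tau>)) {\<tau>..x}" .
    have upper': "((\<lambda>s. arcsine_cdf (\<tau> / s - 1/2)) has_integral
      (x * arcsine_cdf (\<tau> / x - 1/2) + 2 * sqrt (max 0 (\<tau> * (x - \<tau>))) / pi - \<tau>)) {\<tau>..x}"
      by (rule has_integral_eq[OF _ upper]) (simp add: \<Phi>)
    show ?thesis
      using has_integral_combine[OF _ _ arcsine_cdf_integral_ge[of \<tau> \<tau>] upper'] 3 by simp
  qed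
qed

text \<open>The distribution function of the limiting centre of the interval process started from \<^term>\<open>e\<close>.
  An interval of length one never changes, which is the second branch.\<close>

definition limit_cdf :: "real \<Rightarrow> real \<times> real \<Rightarrow> real" where
  "limit_cdf t e = (if excess e > 0 then arcsine_cdf ((t - fst e - 1/2) / excess e - 1/2)
     else if fst e + 1/2 \<le> t then 1 else 0)"

lemma measurable_limit_cdf [measurable]: "limit_cdf t \<in> borel_measurable borel"
  unfolding limit_cdf_def by measurable

lemma limit_cdf_bounds: "0 \<le> limit_cdf t e" "limit_cdf t e \<le> 1"
  by (simp_all add: limit_cdf_def arcsine_cdf_bounds)

text \<open>\<open>snd e - 1/2\<close> is the largest centre of a unit interval inside the current
  one; in the next lemma \<open>fst e + 1/2\<close> is the smallest.\<close>

lemma limit_cdf_eq_1: "snd e - 1/2 \<le> t \<Longrightarrow> 0 \<le> excess e \<Longrightarrow> limit_cdf t e = 1"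
  by (auto simp: limit_cdf_def excess_def field_simps intro!: arcsine_cdf_eq_1)

lemma limit_cdf_eq_0: "t < fst e + 1/2 \<Longrightarrow> limit_cdf t e = 0"
  by (auto simp: limit_cdf_def divide_nonpos_nonneg intro!: arcsine_cdf_eq_0)

text \<open>With e = (a,b), points below b - 1 lower the upper end, points above a + 1 raise the
  lower end, and a middle piece of length 1 - x changes nothing. With h =
  \<open>limit_cdf t e\<close> and r the square root term, the three pieces contribute x h + r, x h
  - r and (1 - x) h, together (1 + x) h.\<close>

lemma limit_cdf_harmonic:
  assumes e: "admissible e"
  shows "((\<lambda>p. limit_cdf t (next_ends e p)) has_integral (snd e - fst e) * limit_cdf t e) {fst e..snd e}"
proof (cases "excess e > 0")
  case False
  then have b: "snd e = fst e + 1" using e by (simp add: excess_def admissible_def)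
  have "((\<lambda>_. limit_cdf t e) has_integral (snd e - fst e) * limit_cdf t e) {fst e..snd e}"
    using has_integral_const_real[of "limit_cdf t e" "fst e" "snd e"] b by simp
  then show ?thesis
  proof (rule has_integral_eq[rotated])
    fix p assume "p \<in> {fst e..snd e}"
    then have "next_ends e p = e" using b by (simp add: next_ends_def prod_eq_iff)
    then show "limit_cdf t e = limit_cdf t (next_ends e p)" by simp
  qed
next
  case True
  define a b x where "a = fst e" and "b = snd e" and "x = excess e"
  have x: "0 < x" "x \<le> 1" "b = a + 1 + x"
    using True excess_admissible[OF e] by (auto simp: x_def a_def b_def excess_def)
  \<comment> \<open>These measure t from the two extreme limiting centres; reflecting the interval
    exchanges them and turns h into 1 - h.\<close>
  define \<tau> \<sigma> where "\<tau> = t - a - 1/2" and "\<sigma> = b - 1/2 - t"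
  have \<sigma>_eq: "\<sigma> = x - \<tau>" using x by (simp add: \<tau>_def \<sigma>_def)
  have \<tau>_eq: "x - \<sigma> = \<tau>" by (simp add: \<sigma>_eq)
  define r where "r = 2 * sqrt (max 0 (\<tau> * \<sigma>)) / pi"
  let ?h = "limit_cdf t e"
  have h: "?h = arcsine_cdf (\<tau> / x - 1/2)"
    using True by (simp add: limit_cdf_def \<tau>_def x_def a_def)
  have h': "arcsine_cdf (\<sigma> / x - 1/2) = 1 - ?h"
  proof -
    have "\<sigma> / x - 1/2 = - (\<tau> / x - 1/2)" using x by (simp add: \<sigma>_eq diff_divide_distrib)
    then show ?thesis by (simp only: h arcsine_cdf_minus)
  qed
  have left: "((\<lambda>p. limit_cdf t (next_ends e p)) has_integral (x * ?h + r)) {a..b - 1}"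
  \<comment> \<open>At p = a the excess drops to 0 and \<open>limit_cdf\<close> takes its second
    branch; a single point does not affect the integral.\<close>
  proof (rule has_integral_spike_finite[of "{a}"])
    have "((\<lambda>s. arcsine_cdf (\<tau> / s - 1/2)) has_integral (x * ?h + r)) (cbox 0 x)"
      using arcsine_cdf_integral[OF x(1), of \<tau>] by (simp add: h r_def \<sigma>_eq)
    from has_integral_affinity[OF this, of 1 "- a"]
    have "((\<lambda>p. arcsine_cdf (\<tau> / (p - a) - 1/2)) has_integral (x * ?h + r)) ((\<lambda>s. s + a) ` {0..x})"
      by simp
    also have "(\<lambda>s. s + a) ` {0..x} = {a..b - 1}" using x by simp
    finally show "((\<lambda>p. arcsine_cdf (\<tau> / (p - a) - 1/2)) has_integral (x * ?h + r)) {a..b - 1}" .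
    fix p assume "p \<in> {a..b - 1} - {a}"
    then have "next_ends e p = (a, p + 1)" "a < p"
      using x by (auto simp: next_ends_def a_def b_def)
    then show "limit_cdf t (next_ends e p) = arcsine_cdf (\<tau> / (p - a) - 1/2)"
      by (simp add: limit_cdf_def excess_def \<tau>_def)
  qed simp
  have right: "((\<lambda>p. limit_cdf t (next_ends e p)) has_integral (x * ?h - r)) {a + 1..b}"
  proof (rule has_integral_spike_finite[of "{b}"])
    have "((\<lambda>s. arcsine_cdf (\<sigma> / s - 1/2)) has_integral (x * (1 - ?h) + r)) {0..x}"
      using arcsine_cdf_integral[OF x(1), of \<sigma>]
      by (simp add: h' r_def \<tau>_eq mult.commute[of \<sigma> \<tau>])
    \<comment> \<open>The reflected integral x (1 - h) + r is subtracted from the integral x of the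
      constant 1; this reverses the sign of r.\<close>
    from has_integral_diff[OF has_integral_const_real[of "1::real" 0 x] this] x
    have "((\<lambda>s. 1 - arcsine_cdf (\<sigma> / s - 1/2)) has_integral (x * ?h - r)) (cbox 0 x)"
      by (simp add: algebra_simps)
    from has_integral_affinity[OF this, of "-1" b]
    have "((\<lambda>p. 1 - arcsine_cdf (\<sigma> / (b - p) - 1/2)) has_integral (x * ?h - r)) ((\<lambda>s. b - s) ` {0..x})"
      by simp
    also have "(\<lambda>s. b - s) ` {0..x} = {a + 1..b}" using x by simp
    finally show "((\<lambda>p. 1 - arcsine_cdf (\<sigma> / (b - p) - 1/2)) has_integral (x * ?h - r)) {a + 1..b}" .
    fix p assume "p \<in> {a + 1..b} - {b}"
    then have p: "next_ends e p = (p - 1, b)" "p < b"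
      using x by (auto simp: next_ends_def a_def b_def)
    have "(t - (p - 1) - 1/2) / (b - p) - 1/2 = - (\<sigma> / (b - p) - 1/2)"
      using p(2) by (simp add: \<sigma>_def field_simps)
    then show "limit_cdf t (next_ends e p) = 1 - arcsine_cdf (\<sigma> / (b - p) - 1/2)"
      using p by (simp add: limit_cdf_def excess_def flip: arcsine_cdf_minus)
  qed simp
  have "((\<lambda>_. ?h) has_integral (1 - x) * ?h) {b - 1..a + 1}"
    using has_integral_const_real[of ?h "b - 1" "a + 1"] x by simp
  then have mid: "((\<lambda>p. limit_cdf t (next_ends e p)) has_integral (1 - x) * ?h) {b - 1..a + 1}"
  proof (rule has_integral_eq[rotated])
    fix p assume "p \<in> {b - 1..a + 1}"
    then have "next_ends e p = e" by (simp add: next_ends_def prod_eq_iff a_def b_def)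
    then show "?h = limit_cdf t (next_ends e p)" by simp
  qed
  have "((\<lambda>p. limit_cdf t (next_ends e p)) has_integral (x * ?h + r + (1 - x) * ?h)) {a..a + 1}"
    by (rule has_integral_combine[OF _ _ left mid]) (use x in auto)
  from has_integral_combine[OF _ _ this right]
  have "((\<lambda>p. limit_cdf t (next_ends e p)) has_integral (x * ?h + r + (1 - x) * ?h + (x * ?h - r))) {a..b}"
    using x by simp
  also have "x * ?h + r + (1 - x) * ?h + (x * ?h - r) = (b - a) * ?h"
    using x by (simp add: algebra_simps)
  finally show ?thesis by (simp add: a_def b_def)
qed

text \<open>Harmonicity keeps the expectation constant. At the start [-1,1] the excess is 1 and the
  limiting centres fill [-1/2,1/2], so no rescaling remains.\<close>

lemma integral_limit_cdf: "(\<integral>e. limit_cdf t e \<partial>ends_law n) = arcsine_cdf t"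
proof (induction n)
  case 0
  have "(\<integral>e. limit_cdf t e \<partial>ends_law 0) = limit_cdf t (-1, 1)"
    by (simp add: integral_eq_nn_integral limit_cdf_bounds nn_integral_ends_law_0)
  also have "\<dots> = arcsine_cdf t" by (simp add: limit_cdf_def excess_def)
  finally show ?case .
next
  case (Suc n)
  have "(\<integral>e. limit_cdf t e \<partial>ends_law (Suc n)) = (\<integral>e. limit_cdf t e \<partial>ends_law n)"
    by (rule integral_ends_law_Suc) (simp_all add: limit_cdf_bounds limit_cdf_harmonic)
  then show ?case by (simp add: Suc)
qed

definition centre :: "real \<times> real \<Rightarrow> real" where
  "centre e = (fst e + snd e) / 2"

lemma measurable_centre [measurable]: "centre \<in> borel_measurable borel"
  unfolding centre_def by measurable

lemma integrable_indicator_ends_law: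
  "A \<in> sets borel \<Longrightarrow> integrable (ends_law n) (indicator A :: _ \<Rightarrow> real)"
  by (rule integrable_ends_law[where B=1]) (auto simp: indicator_def)

text \<open>Every possible limiting centre is within half the excess of the current centre. If the
  excess is at most 2 \<epsilon>, shifting t by \<epsilon> thus forces \<open>limit_cdf\<close> to
  be 1 in the first bound and 0 in the second; the tail pays for the other event.\<close>

lemma centre_cdf_bounds:
  "measure (ends_law n) {e. centre e \<le> t} \<le> arcsine_cdf (t + \<epsilon>) + excess_tail n (2 * \<epsilon>)"
  "arcsine_cdf (t - \<epsilon>) - excess_tail n (2 * \<epsilon>) \<le> measure (ends_law n) {e. centre e \<le> t}"
proof -
  have int [simp]: "integrable (ends_law n) (limit_cdf t)" for t
    by (rule integrable_ends_law[where B=1]) (simp_all add: limit_cdf_bounds)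
  have [simp]: "integrable (ends_law n) (indicator {e. centre e \<le> t} :: _ \<Rightarrow> real)"
    "integrable (ends_law n) (indicator {e. t < excess e} :: _ \<Rightarrow> real)" for t
    by (rule integrable_indicator_ends_law; simp)+
  have "(\<integral>e. indicator {e. centre e \<le> t} e \<partial>ends_law n)
      \<le> (\<integral>e. limit_cdf (t + \<epsilon>) e + indicator {e. 2 * \<epsilon> < excess e} e \<partial>ends_law n)"
  proof (rule integral_ends_law_mono[where B=1 and C=2])
    fix e assume e: "admissible e"
    show "indicator {e. centre e \<le> t} e \<le> limit_cdf (t + \<epsilon>) e + indicator {e. 2 * \<epsilon> < excess e} e"
    proof (cases "centre e \<le> t \<and> \<not> 2 * \<epsilon> < excess e")
      case True
      then have "limit_cdf (t + \<epsilon>) e = 1"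
        using excess_admissible[OF e] by (intro limit_cdf_eq_1) (auto simp: centre_def excess_def)
      then show ?thesis by (simp add: indicator_def)
    qed (auto simp: indicator_def limit_cdf_bounds)
    show "\<bar>limit_cdf (t + \<epsilon>) e + indicator {e. 2 * \<epsilon> < excess e} e\<bar> \<le> 2"
      using limit_cdf_bounds[of "t + \<epsilon>" e] by (auto simp: indicator_def)
  qed (auto simp: indicator_def)
  then show "measure (ends_law n) {e. centre e \<le> t} \<le> arcsine_cdf (t + \<epsilon>) + excess_tail n (2 * \<epsilon>)"
    by (simp add: integral_limit_cdf excess_tail_def)
  have "(\<integral>e. limit_cdf (t - \<epsilon>) e \<partial>ends_law n)
      \<le> (\<integral>e. indicator {e. centre e \<le> t} e + indicator {e. 2 * \<epsilon> < excess e} e \<partial>ends_law n)"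
  proof (rule integral_ends_law_mono[where B=1 and C=2])
    fix e assume e: "admissible e"
    show "limit_cdf (t - \<epsilon>) e \<le> indicator {e. centre e \<le> t} e + indicator {e. 2 * \<epsilon> < excess e} e"
    proof (cases "\<not> centre e \<le> t \<and> \<not> 2 * \<epsilon> < excess e")
      case True
      then have "limit_cdf (t - \<epsilon>) e = 0"
        by (intro limit_cdf_eq_0) (auto simp: centre_def excess_def)
      then show ?thesis by (simp add: indicator_def)
    qed (use limit_cdf_bounds[of "t - \<epsilon>" e] in \<open>auto simp: indicator_def\<close>)
  qed (auto simp: indicator_def limit_cdf_bounds)
  then show "arcsine_cdf (t - \<epsilon>) - excess_tail n (2 * \<epsilon>) \<le> measure (ends_law n) {e. centre e \<le> t}"
    by (simp add: integral_limit_cdf excess_tail_def)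
qed

lemma excess_tail_tendsto_0:
  assumes "0 < t" "t \<le> 1"
  shows "(\<lambda>n. excess_tail n t) \<longlonglongrightarrow> 0"
proof (rule tendsto_sandwich[of "\<lambda>_. 0" _ _ "\<lambda>n. (1 - t) ^ n"])
  show "(\<lambda>n. (1 - t) ^ n) \<longlonglongrightarrow> 0" using assms by (intro LIMSEQ_power_zero) auto
qed (use assms in \<open>auto simp: excess_tail_bounds excess_tail_le_power\<close>)

lemma centre_cdf_limit: "(\<lambda>n. measure (ends_law n) {e. centre e \<le> t}) \<longlonglongrightarrow> arcsine_cdf t"
proof (rule order_tendstoI)
  have right: "((\<lambda>\<epsilon>. arcsine_cdf (t + \<epsilon>)) \<longlongrightarrow> arcsine_cdf (t + 0)) (at_right 0)"
    by (rule continuous_on_tendsto_compose[OF continuous_arcsine_cdf tendsto_add[OF tendsto_const tendsto_ident_at]]; simp)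
  have left: "((\<lambda>\<epsilon>. arcsine_cdf (t - \<epsilon>)) \<longlongrightarrow> arcsine_cdf (t - 0)) (at_right 0)"
    by (rule continuous_on_tendsto_compose[OF continuous_arcsine_cdf tendsto_diff[OF tendsto_const tendsto_ident_at]]; simp)
  \<comment> \<open>This keeps the level \<open>2 * \<epsilon>\<close> below 1, as
    \<open>excess_tail_tendsto_0\<close> requires.\<close>
  have small: "eventually (\<lambda>\<epsilon>::real. \<epsilon> \<in> {0<..<1/2}) (at_right 0)"
    by (rule eventually_at_right_real) simp
  fix y
  {
    assume "y < arcsine_cdf t"
    then have "eventually (\<lambda>\<epsilon>. y < arcsine_cdf (t - \<epsilon>)) (at_right 0)"
      using order_tendstoD(1)[OF left] by simp
    from eventually_happens'[OF _ eventually_conj[OF this small]]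
    obtain \<epsilon> where \<epsilon>: "0 < \<epsilon>" "\<epsilon> < 1/2" "y < arcsine_cdf (t - \<epsilon>)" by auto
    have "(\<lambda>n. arcsine_cdf (t - \<epsilon>) - excess_tail n (2 * \<epsilon>)) \<longlonglongrightarrow> arcsine_cdf (t - \<epsilon>) - 0"
      using \<epsilon> by (intro tendsto_intros excess_tail_tendsto_0) auto
    then have "eventually (\<lambda>n. y < arcsine_cdf (t - \<epsilon>) - excess_tail n (2 * \<epsilon>)) sequentially"
      by (rule order_tendstoD(1)) (use \<epsilon> in simp)
    then show "eventually (\<lambda>n. y < measure (ends_law n) {e. centre e \<le> t}) sequentially"
      by eventually_elim (rule less_le_trans[OF _ centre_cdf_bounds(2)])
  }
  assume "arcsine_cdf t < y"
  then have "eventually (\<lambda>\<epsilon>. arcsine_cdf (t + \<epsilon>) < y) (at_right 0)"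
    using order_tendstoD(2)[OF right] by simp
  from eventually_happens'[OF _ eventually_conj[OF this small]]
  obtain \<epsilon> where \<epsilon>: "0 < \<epsilon>" "\<epsilon> < 1/2" "arcsine_cdf (t + \<epsilon>) < y" by auto
  have "(\<lambda>n. arcsine_cdf (t + \<epsilon>) + excess_tail n (2 * \<epsilon>)) \<longlonglongrightarrow> arcsine_cdf (t + \<epsilon>) + 0"
    using \<epsilon> by (intro tendsto_intros excess_tail_tendsto_0) auto
  then have "eventually (\<lambda>n. arcsine_cdf (t + \<epsilon>) + excess_tail n (2 * \<epsilon>) < y) sequentially"
    by (rule order_tendstoD(2)) (use \<epsilon> in simp)
  then show "eventually (\<lambda>n. measure (ends_law n) {e. centre e \<le> t} < y) sequentially"
    by eventually_elim (rule le_less_trans[OF centre_cdf_bounds(1)])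
qed

section \<open>The density of the arcsine law\<close>

lemma measurable_arcsine_half_density [measurable]: "arcsine_half_density \<in> borel_measurable borel"
  unfolding arcsine_half_density_def by measurable

lemma arcsine_half_density_nonneg: "0 \<le> arcsine_half_density x"
  by (simp add: arcsine_half_density_def)

lemma arcsine_half_density_integral:
  "((\<lambda>x. if x \<le> t then arcsine_half_density x else 0) has_integral arcsine_cdf t) UNIV"
proof (cases "t \<le> -1/2")
  case True
  have "((\<lambda>x. if x \<le> t then arcsine_half_density x else 0) has_integral 0) UNIV"
    by (rule has_integral_is_0) (use True in \<open>auto simp: arcsine_half_density_def\<close>)
  then show ?thesis using True by (simp add: arcsine_cdf_eq_0)
next
  case False
  \<comment> \<open>Beyond 1/2 the density vanishes and \<open>arcsine_cdf\<close> is constant. The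
    density blows up at the ends of the support, so the antiderivative is differentiated in the
    interior only.\<close>
  define u where "u = min t (1/2)"
  have u: "-1/2 < u" "u \<le> 1/2" using False by (auto simp: u_def)
  have "(arcsine_half_density has_integral (arcsine_cdf u - arcsine_cdf (-1/2))) {-1/2..u}"
  proof (rule fundamental_theorem_of_calculus_interior)
    show "continuous_on {-1/2..u} arcsine_cdf"
      using continuous_arcsine_cdf by (rule continuous_on_subset) simp
    fix x assume x: "x \<in> {-1/2<..<u}"
    have root: "sqrt (1 - (2 * x)\<^sup>2) = 2 * sqrt ((1/2 + x) * (1/2 - x))"
    proof -
      have "1 - (2 * x)\<^sup>2 = 4 * ((1/2 + x) * (1/2 - x))" by (simp add: power2_eq_square algebra_simps)
      then show ?thesis by (simp add: real_sqrt_mult del: distrib_left_numeral right_diff_distrib_numeral)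
    qed
    have "((\<lambda>y. 1 / 2 + arcsin (2 * y) / pi) has_real_derivative inverse (sqrt (1 - (2 * x)\<^sup>2)) * 2 / pi) (at x)"
      using x u by (auto intro!: derivative_eq_intros)
    also have "inverse (sqrt (1 - (2 * x)\<^sup>2)) * 2 / pi = arcsine_half_density x"
      unfolding root using x u by (simp add: arcsine_half_density_def field_simps)
    finally have "(arcsine_cdf has_real_derivative arcsine_half_density x) (at x)"
      by (rule has_field_derivative_transform_within_open[where S="{-1/2<..<u}"])
         (use x u in \<open>auto simp: arcsine_cdf_mid abs_le_iff\<close>)
    then show "(arcsine_cdf has_vector_derivative arcsine_half_density x) (at x)"
      by (simp add: has_real_derivative_iff_has_vector_derivative)
  qed (use u in simp)
  also have "arcsine_cdf u - arcsine_cdf (-1/2) = arcsine_cdf t"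
    by (auto simp: u_def min_def arcsine_cdf_eq_0 arcsine_cdf_eq_1)
  finally have "((\<lambda>x. if x \<in> {-1/2..u} then arcsine_half_density x else 0) has_integral arcsine_cdf t) UNIV"
    by (simp only: has_integral_restrict_UNIV)
  also have "(\<lambda>x. if x \<in> {-1/2..u} then arcsine_half_density x else 0) =
      (\<lambda>x. if x \<le> t then arcsine_half_density x else 0)"
    by (auto simp: fun_eq_iff u_def arcsine_half_density_def)
  finally show ?thesis .
qed

lemma emeasure_arcsine_law: "emeasure (density lborel arcsine_half_density) {..t} = ennreal (arcsine_cdf t)"
proof -
  have "emeasure (density lborel arcsine_half_density) {..t} =
      (\<integral>\<^sup>+x. ennreal (if x \<le> t then arcsine_half_density x else 0) \<partial>lborel)"
    by (subst emeasure_density) (auto intro!: nn_integral_cong simp: indicator_def)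
  also have "\<dots> = ennreal (arcsine_cdf t)"
    by (rule nn_integral_has_integral_lborel[OF _ _ arcsine_half_density_integral])
       (auto simp: arcsine_half_density_nonneg)
  finally show ?thesis .
qed

lemma real_distribution_arcsine_law: "real_distribution (density lborel arcsine_half_density)"
proof -
  have "(\<integral>\<^sup>+x. ennreal (arcsine_half_density x) \<partial>lborel) =
      (\<integral>\<^sup>+x. ennreal (if x \<le> 1 then arcsine_half_density x else 0) \<partial>lborel)"
    by (rule nn_integral_cong) (simp add: arcsine_half_density_def)
  also have "\<dots> = ennreal (arcsine_cdf 1)"
    by (rule nn_integral_has_integral_lborel[OF _ _ arcsine_half_density_integral])
       (auto simp: arcsine_half_density_nonneg)
  finally have "prob_space (density lborel arcsine_half_density)"
    by (intro prob_spaceI) (simp add: emeasure_density arcsine_cdf_eq_1)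
  then show ?thesis by (simp add: real_distribution_def real_distribution_axioms_def)
qed

lemma cdf_arcsine_law: "cdf (density lborel arcsine_half_density) t = arcsine_cdf t"
  by (simp add: cdf_def measure_def emeasure_arcsine_law arcsine_cdf_bounds)

section \<open>Weak convergence of product laws\<close>

lemma borel_measurable_vecI:
  fixes f :: "'a \<Rightarrow> real^'d"
  assumes "\<And>i. (\<lambda>x. f x $ i) \<in> borel_measurable M"
  shows "f \<in> borel_measurable M"
proof (subst borel_measurable_euclidean_space, rule ballI)
  fix b :: "real^'d" assume "b \<in> Basis"
  then obtain i where "b = axis i 1" by (auto simp: Basis_vec_def)
  then have "(\<lambda>x. f x \<bullet> b) = (\<lambda>x. f x $ i)" by (simp add: inner_axis)
  with assms[of i] show "(\<lambda>x. f x \<bullet> b) \<in> borel_measurable M" by (simp only:)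
qed

lemma measurable_vec_lambda_PiM:
  assumes "\<And>i. sets (\<mu> i) = sets (borel :: real measure)"
  shows "(\<lambda>\<omega>. \<chi> i. \<omega> i) \<in> PiM (UNIV :: 'd::finite set) \<mu> \<rightarrow>\<^sub>M (borel :: (real^'d) measure)"
proof (rule borel_measurable_vecI)
  fix i :: 'd
  have "(\<lambda>\<omega>. \<omega> i) \<in> PiM UNIV \<mu> \<rightarrow>\<^sub>M \<mu> i" by (rule measurable_component_singleton) simp
  also have "PiM UNIV \<mu> \<rightarrow>\<^sub>M \<mu> i = borel_measurable (PiM UNIV \<mu>)"
    by (rule measurable_cong_sets[OF refl assms])
  finally show "(\<lambda>\<omega>. (\<chi> i. \<omega> i) $ i) \<in> borel_measurable (PiM UNIV \<mu>)"
    by (simp only: vec_lambda_beta)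
qed

text \<open>Boxes identify a finite product measure: \<open>N\<close> is carried over to functions
  on the index set, compared with \<open>PiM\<close> there, and mapped back.\<close>

lemma vec_law_eqI:
  fixes N :: "(real^'d) measure" and \<mu> :: "'d \<Rightarrow> real measure"
  assumes N: "sets N = sets borel" and \<mu>: "\<And>i. real_distribution (\<mu> i)"
    and eq: "\<And>A. (\<And>i. A i \<in> sets borel) \<Longrightarrow> emeasure N {x. \<forall>i. x $ i \<in> A i} = (\<Prod>i\<in>UNIV. emeasure (\<mu> i) (A i))"
  shows "N = distr (PiM UNIV \<mu>) borel (\<lambda>\<omega>. \<chi> i. \<omega> i)"
proof -
  interpret \<mu>: real_distribution "\<mu> i" for i by (rule \<mu>)
  interpret product_sigma_finite \<mu> ..
  let ?v = "\<lambda>x :: real^'d. \<lambda>i. x $ i"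
  have v: "?v \<in> N \<rightarrow>\<^sub>M PiM UNIV \<mu>"
    by (rule measurable_PiM_single')
       (simp_all add: measurable_cong_sets[OF N \<mu>.events_eq_borel])
  have "distr N (PiM UNIV \<mu>) ?v = PiM UNIV \<mu>"
  proof (rule PiM_eqI)
    fix A assume A: "\<And>i. i \<in> UNIV \<Longrightarrow> A i \<in> sets (\<mu> i)"
    have "emeasure (distr N (PiM UNIV \<mu>) ?v) (Pi\<^sub>E UNIV A) = emeasure N (?v -` Pi\<^sub>E UNIV A \<inter> space N)"
      by (rule emeasure_distr[OF v]) (use A in \<open>auto intro!: sets_PiM_I_finite\<close>)
    also have "?v -` Pi\<^sub>E UNIV A \<inter> space N = {x. \<forall>i. x $ i \<in> A i}"
      using sets_eq_imp_space_eq[OF N] by (auto simp: PiE_def)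
    finally show "emeasure (distr N (PiM UNIV \<mu>) ?v) (Pi\<^sub>E UNIV A) = (\<Prod>i\<in>UNIV. emeasure (\<mu> i) (A i))"
      using eq[of A] A by simp
  qed simp_all
  then have "distr (PiM UNIV \<mu>) borel (\<lambda>\<omega>. \<chi> i. \<omega> i) =
      distr (distr N (PiM UNIV \<mu>) ?v) borel (\<lambda>\<omega>. \<chi> i. \<omega> i)" by (simp only:)
  also have "\<dots> = distr N borel ((\<lambda>\<omega>. \<chi> i. \<omega> i) \<circ> ?v)"
    by (rule distr_distr[OF measurable_vec_lambda_PiM v]) (rule \<mu>.events_eq_borel)
  also have "\<dots> = N"
    unfolding comp_def vec_nth_inverse using N[symmetric] by (rule distr_id2)
  finally show ?thesis by simp
qed

lemma vec_law_distr:
  fixes Y :: "real \<Rightarrow> real"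
  assumes "prob_space \<Omega>" and Y [measurable]: "Y \<in> borel_measurable \<Omega>"
  shows "distr (PiM (UNIV :: 'd::finite set) (\<lambda>_. distr \<Omega> borel Y)) borel (\<lambda>\<omega>. \<chi> i. \<omega> i) =
    distr (PiM UNIV (\<lambda>_. \<Omega>)) borel (\<lambda>\<omega>. \<chi> i. Y (\<omega> i))"
proof (rule vec_law_eqI[symmetric])
  interpret \<Omega>: prob_space \<Omega> by fact
  interpret product_sigma_finite "\<lambda>_::'d. \<Omega>" ..
  show "real_distribution (distr \<Omega> borel Y)" by simp
  have m [measurable]: "(\<lambda>\<omega>. \<chi> i. Y (\<omega> i)) \<in> PiM (UNIV :: 'd set) (\<lambda>_. \<Omega>) \<rightarrow>\<^sub>M borel"
    by (rule borel_measurable_vecI) simp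
  fix A :: "'d \<Rightarrow> real set" assume A [measurable]: "\<And>i. A i \<in> sets borel"
  have [measurable]: "{x :: real^'d. \<forall>i. x $ i \<in> A i} \<in> sets borel" by measurable
  have "emeasure (distr (PiM (UNIV :: 'd set) (\<lambda>_. \<Omega>)) borel (\<lambda>\<omega>. \<chi> i. Y (\<omega> i))) {x. \<forall>i. x $ i \<in> A i} =
      emeasure (PiM UNIV (\<lambda>_. \<Omega>)) (Pi\<^sub>E UNIV (\<lambda>i. Y -` A i \<inter> space \<Omega>))"
    by (subst emeasure_distr) (auto intro!: arg_cong2[where f=emeasure] simp: space_PiM PiE_def Pi_def)
  also have "\<dots> = (\<Prod>i\<in>UNIV. emeasure \<Omega> (Y -` A i \<inter> space \<Omega>))"
    by (rule emeasure_PiM) auto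
  also have "\<dots> = (\<Prod>i\<in>UNIV. emeasure (distr \<Omega> borel Y) (A i))"
    by (simp add: emeasure_distr)
  finally show "emeasure (distr (PiM (UNIV :: 'd set) (\<lambda>_. \<Omega>)) borel (\<lambda>\<omega>. \<chi> i. Y (\<omega> i))) {x. \<forall>i. x $ i \<in> A i} =
      (\<Prod>i\<in>UNIV. emeasure (distr \<Omega> borel Y) (A i))" .
qed simp

text \<open>A power of the one Skorohod space carries all prelimit vectors and the limit vector at
  once, each with independent coordinates of the right law. There the vectors converge at every
  point, so dominated convergence applies to each bounded continuous f.\<close>

lemma conv_distr_vec_law:
  assumes \<mu>: "\<And>n. real_distribution (\<mu> n)" and M: "real_distribution M" and conv: "weak_conv_m \<mu> M"
  shows "conv_distr (\<lambda>n. distr (PiM (UNIV :: 'd::finite set) (\<lambda>_. \<mu> n)) borel (\<lambda>\<omega>. \<chi> i. \<omega> i))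
    (distr (PiM UNIV (\<lambda>_. M)) borel (\<lambda>\<omega>. \<chi> i. \<omega> i))"
proof -
  obtain \<Omega> :: "real measure" and Ys :: "nat \<Rightarrow> real \<Rightarrow> real" and Y :: "real \<Rightarrow> real" where
    \<Omega>: "prob_space \<Omega>" and Ys [measurable]: "\<And>n. Ys n \<in> borel_measurable \<Omega>"
    and Ys_law: "\<And>n. distr \<Omega> borel (Ys n) = \<mu> n"
    and Y: "Y \<in> \<Omega> \<rightarrow>\<^sub>M lborel" and Y_law: "distr \<Omega> borel Y = M"
    and lim: "\<And>x. x \<in> space \<Omega> \<Longrightarrow> (\<lambda>n. Ys n x) \<longlonglongrightarrow> Y x"
    using Skorohod[OF \<mu> M conv] by blast
  have Y [measurable]: "Y \<in> borel_measurable \<Omega>" using Y by simp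
  interpret \<Omega>: prob_space \<Omega> by fact
  interpret product_prob_space "\<lambda>_::'d. \<Omega>" UNIV ..
  let ?P = "PiM (UNIV :: 'd set) (\<lambda>_. \<Omega>)"
  have Z: "(\<lambda>\<omega>. \<chi> i. Z (\<omega> i)) \<in> ?P \<rightarrow>\<^sub>M (borel :: (real^'d) measure)" if "Z \<in> borel_measurable \<Omega>" for Z
    using that by (intro borel_measurable_vecI) simp
  note Zs [measurable] = Z[OF Ys] Z[OF Y]
  show ?thesis
    unfolding conv_distr_def
  proof (intro allI impI)
    fix f :: "real^'d \<Rightarrow> real" assume f: "continuous_on UNIV f" and bdd: "bounded (range f)"
    have [measurable]: "f \<in> borel_measurable borel" by (rule borel_measurable_continuous_onI[OF f])
    obtain B where B: "\<And>x. norm (f x) \<le> B" using bdd by (auto simp: bounded_iff)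
    have "(\<lambda>n. \<integral>\<omega>. f (\<chi> i. Ys n (\<omega> i)) \<partial>?P) \<longlonglongrightarrow> (\<integral>\<omega>. f (\<chi> i. Y (\<omega> i)) \<partial>?P)"
    proof (rule integral_dominated_convergence[where w="\<lambda>_. B"])
      show "AE \<omega> in ?P. (\<lambda>n. f (\<chi> i. Ys n (\<omega> i))) \<longlonglongrightarrow> f (\<chi> i. Y (\<omega> i))"
      proof (rule AE_I2)
        fix \<omega> assume "\<omega> \<in> space ?P"
        then have "(\<lambda>n. \<chi> i. Ys n (\<omega> i)) \<longlonglongrightarrow> (\<chi> i. Y (\<omega> i))"
          by (intro tendsto_vec_lambda lim) (auto simp: space_PiM)
        then show "(\<lambda>n. f (\<chi> i. Ys n (\<omega> i))) \<longlonglongrightarrow> f (\<chi> i. Y (\<omega> i))"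
          by (rule continuous_on_tendsto_compose[OF f]) auto
      qed
    qed (use B in auto)
    then show "(\<lambda>n. \<integral>x. f x \<partial>distr (PiM UNIV (\<lambda>_. \<mu> n)) borel (\<lambda>\<omega>. \<chi> i. \<omega> i))
        \<longlonglongrightarrow> (\<integral>x. f x \<partial>distr (PiM UNIV (\<lambda>_. M)) borel (\<lambda>\<omega>. \<chi> i. \<omega> i))"
      by (simp add: vec_law_distr[OF \<Omega>] integral_distr flip: Ys_law Y_law)
  qed
qed

lemma density_vec_law:
  fixes g :: "real \<Rightarrow> real"
  assumes g [measurable]: "g \<in> borel_measurable borel" and nn: "\<And>x. 0 \<le> g x"
    and "real_distribution (density lborel g)"
  shows "density lborel (\<lambda>x :: real^'d. \<Prod>i\<in>UNIV. g (x $ i)) =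
    distr (PiM UNIV (\<lambda>_. density lborel g)) borel (\<lambda>\<omega>. \<chi> i. \<omega> i)"
proof (rule vec_law_eqI)
  fix A :: "'d \<Rightarrow> real set" assume A [measurable]: "\<And>i. A i \<in> sets borel"
  have [measurable]: "{x :: real^'d. \<forall>i. x $ i \<in> A i} \<in> sets borel" by measurable
  have ind: "indicator {x :: real^'d. \<forall>i. x $ i \<in> A i} x = (\<Prod>i\<in>UNIV. indicator (A i) (x $ i) :: ennreal)" for x
    by (auto simp: indicator_def intro!: prod.neutral[symmetric])
  have "emeasure (density lborel (\<lambda>x :: real^'d. \<Prod>i\<in>UNIV. g (x $ i))) {x. \<forall>i. x $ i \<in> A i} =
      (\<integral>\<^sup>+x. (\<Prod>i\<in>UNIV. ennreal (g (x $ i)) * indicator (A i) (x $ i)) \<partial>(lborel :: (real^'d) measure))"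
    by (subst emeasure_density) (simp_all add: ind prod.distrib prod_ennreal nn)
  also have "\<dots> = (\<Prod>i\<in>UNIV. \<integral>\<^sup>+y. ennreal (g y) * indicator (A i) y \<partial>lborel)"
    by (rule nn_integral_lborel_vec) measurable
  also have "\<dots> = (\<Prod>i\<in>UNIV. emeasure (density lborel g) (A i))"
    by (simp add: emeasure_density)
  finally show "emeasure (density lborel (\<lambda>x :: real^'d. \<Prod>i\<in>UNIV. g (x $ i))) {x. \<forall>i. x $ i \<in> A i} =
      (\<Prod>i\<in>UNIV. emeasure (density lborel g) (A i))" .
qed (use assms in simp_all)

text \<open>The maximum is at most t exactly on a box with equal sides, whose probability is a
  power.\<close>

lemma cdf_max_vec_law:
  assumes "real_distribution M"
  shows "cdf (distr (distr (PiM UNIV (\<lambda>_. M)) borel (\<lambda>\<omega>. \<chi> i. \<omega> i)) borel (\<lambda>x :: real^'d. Max (range (($) x)))) t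
    = cdf M t ^ CARD('d)"
proof -
  interpret M: real_distribution M by fact
  interpret product_prob_space "\<lambda>_::'d. M" UNIV ..
  have max: "(\<lambda>x :: real^'d. Max (range (($) x))) \<in> borel_measurable borel"
    by (rule borel_measurable_Max) simp_all
  have vec: "(\<lambda>\<omega>. \<chi> i. \<omega> i) \<in> PiM (UNIV :: 'd set) (\<lambda>_. M) \<rightarrow>\<^sub>M borel"
    by (rule measurable_vec_lambda_PiM) simp
  have pre: "{x :: real^'d. Max (range (($) x)) \<le> t} \<in> sets borel"
    using measurable_sets[OF max, of "{..t}"] by (simp add: vimage_def)
  have "cdf (distr (distr (PiM UNIV (\<lambda>_. M)) borel (\<lambda>\<omega>. \<chi> i. \<omega> i)) borel (\<lambda>x :: real^'d. Max (range (($) x)))) t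
      = measure (PiM UNIV (\<lambda>_. M)) (Pi\<^sub>E UNIV (\<lambda>_::'d. {..t}))"
    unfolding cdf_def
    by (subst measure_distr[of "\<lambda>x. Max (range (($) x))"], use max in simp, simp,
        subst measure_distr[OF vec]) (use pre in \<open>auto simp: vimage_def space_PiM PiE_def Pi_def intro!: arg_cong2[where f=measure]\<close>)
  also have "\<dots> = cdf M t ^ CARD('d)"
  proof -
    have "ennreal (measure (PiM UNIV (\<lambda>_. M)) (Pi\<^sub>E UNIV (\<lambda>_::'d. {..t}))) = ennreal (cdf M t ^ CARD('d))"
      using emeasure_PiM[of UNIV "\<lambda>_::'d. {..t}"]
      by (simp add: M.emeasure_eq_measure P.emeasure_eq_measure cdf_def ennreal_power)
    then show ?thesis by (simp add: cdf_def)
  qed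
  finally show ?thesis .
qed

section \<open>Edges and centres of the cube process as product laws\<close>

abbreviation ends_at :: "nat \<Rightarrow> (nat \<Rightarrow> real^'d) \<Rightarrow> 'd \<Rightarrow> real \<times> real" where
  "ends_at n ps i \<equiv> (lower_end n (\<lambda>j. ps j $ i), upper_end n (\<lambda>j. ps j $ i))"

lemma measurable_ends_at [measurable]:
  fixes i :: "'d::finite"
  shows "(\<lambda>ps. ends_at n ps i) \<in> PiM {..<n} (\<lambda>_. lborel) \<rightarrow>\<^sub>M borel"
proof (rule borel_measurable_Pair)
  have coord: "(\<lambda>ps :: nat \<Rightarrow> real^'d. ps j $ i) \<in> borel_measurable (PiM {..<n} (\<lambda>_. lborel))"
    if "j < n" for j
  proof -
    have p: "(\<lambda>ps. ps j :: real^'d) \<in> PiM {..<n} (\<lambda>_. lborel) \<rightarrow>\<^sub>M borel"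
      using measurable_component_singleton[of j "{..<n}" "\<lambda>_. lborel :: (real^'d) measure"] that by simp
    show ?thesis using measurable_compose[OF p borel_measurable_vec_nth[of i]] by simp
  qed
  show "(\<lambda>ps :: nat \<Rightarrow> real^'d. lower_end n (\<lambda>j. ps j $ i)) \<in> borel_measurable (PiM {..<n} (\<lambda>_. lborel))"
    by (rule measurable_lower_end) (rule coord)
  show "(\<lambda>ps :: nat \<Rightarrow> real^'d. upper_end n (\<lambda>j. ps j $ i)) \<in> borel_measurable (PiM {..<n} (\<lambda>_. lborel))"
    by (rule measurable_upper_end) (rule coord)
qed

lemma AE_cube_law_admissible:
  "AE ps in dim_law (cube :: (real^'d) set) cube n. \<forall>i. admissible (ends_at n ps i)"
proof (subst AE_all_countable, rule allI)
  fix i :: 'd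
  have [measurable]: "{e. \<not> admissible e} \<in> sets borel"
    unfolding admissible_def by measurable
  \<comment> \<open>The constant 1 in all other coordinates isolates coordinate i in the product
    formula.\<close>
  let ?f = "\<lambda>j. if j = i then indicator {e. \<not> admissible e} else (\<lambda>_. 1 :: ennreal)"
  have zero: "(\<integral>\<^sup>+e. indicator {e. \<not> admissible e} e \<partial>ends_law n) = 0"
    using AE_ends_law_admissible[of n] by (subst nn_integral_0_iff_AE) (auto elim!: eventually_mono)
  have "(\<integral>\<^sup>+ps. indicator {e. \<not> admissible e} (ends_at n ps i) \<partial>dim_law (cube :: (real^'d) set) cube n)
      = (\<integral>\<^sup>+ps. (\<Prod>j\<in>UNIV. ?f j (ends_at n ps j)) \<partial>dim_law (cube :: (real^'d) set) cube n)"
    by (intro nn_integral_cong) (simp add: if_distrib[where f="\<lambda>h. h _"] cong: if_cong)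
  also have "\<dots> = (\<Prod>j\<in>UNIV. \<integral>\<^sup>+e. ?f j e \<partial>ends_law n)"
    by (rule nn_integral_cube_law_prod) auto
  also have "\<dots> = 0"
    by (rule prod_zero) (auto intro!: bexI[of _ i] simp: zero)
  finally have "(\<integral>\<^sup>+ps. indicator {e. \<not> admissible e} (ends_at n ps i) \<partial>dim_law (cube :: (real^'d) set) cube n) = 0" .
  moreover have "(\<lambda>ps :: nat \<Rightarrow> real^'d. indicator {e. \<not> admissible e} (ends_at n ps i) :: ennreal)
      \<in> borel_measurable (dim_law cube cube n)"
    by measurable
  ultimately show "AE ps in dim_law (cube :: (real^'d) set) cube n. admissible (ends_at n ps i)"
    by (subst (asm) nn_integral_0_iff_AE) (auto simp: indicator_def elim!: eventually_mono)
qed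

lemma cube_law_vec_law:
  fixes g :: "real \<times> real \<Rightarrow> real"
  assumes g [measurable]: "g \<in> borel_measurable borel"
  shows "distr (dim_law (cube :: (real^'d) set) cube n) borel (\<lambda>ps. \<chi> i. g (ends_at n ps i)) =
    distr (PiM UNIV (\<lambda>_. distr (ends_law n) borel g)) borel (\<lambda>\<omega>. \<chi> i. \<omega> i)"
proof (rule vec_law_eqI)
  interpret prob_space "ends_law n" by (rule prob_space_ends_law)
  show "real_distribution (distr (ends_law n) borel g)" by simp
  have m: "(\<lambda>ps. \<chi> i. g (ends_at n ps i)) \<in> dim_law (cube :: (real^'d) set) cube n \<rightarrow>\<^sub>M borel"
    by (rule borel_measurable_vecI) simp
  fix A :: "'d \<Rightarrow> real set" assume A [measurable]: "\<And>i. A i \<in> sets borel"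
  have [measurable]: "{x :: real^'d. \<forall>i. x $ i \<in> A i} \<in> sets borel" by measurable
  have ind: "indicator {x :: real^'d. \<forall>i. x $ i \<in> A i} x = (\<Prod>i\<in>UNIV. indicator (A i) (x $ i) :: ennreal)" for x
    by (auto simp: indicator_def intro!: prod.neutral[symmetric])
  have "emeasure (distr (dim_law (cube :: (real^'d) set) cube n) borel (\<lambda>ps. \<chi> i. g (ends_at n ps i)))
      {x. \<forall>i. x $ i \<in> A i} = (\<integral>\<^sup>+x. (\<Prod>i\<in>UNIV. indicator (A i) (x $ i))
        \<partial>distr (dim_law (cube :: (real^'d) set) cube n) borel (\<lambda>ps. \<chi> i. g (ends_at n ps i)))"
    by (simp flip: ind)
  also have "\<dots> = (\<integral>\<^sup>+ps. (\<Prod>i\<in>UNIV. indicator (A i) (g (ends_at n ps i))) \<partial>dim_law (cube :: (real^'d) set) cube n)"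
    by (subst nn_integral_distr[OF m]) simp_all
  also have "\<dots> = (\<Prod>i\<in>UNIV. \<integral>\<^sup>+e. indicator (A i) (g e) \<partial>ends_law n)"
    by (rule nn_integral_cube_law_prod) measurable
  also have "\<dots> = (\<Prod>i\<in>UNIV. \<integral>\<^sup>+y. indicator (A i) y \<partial>distr (ends_law n) borel g)"
    by (intro prod.cong refl nn_integral_distr[symmetric]) simp_all
  finally show "emeasure (distr (dim_law (cube :: (real^'d) set) cube n) borel (\<lambda>ps. \<chi> i. g (ends_at n ps i)))
      {x. \<forall>i. x $ i \<in> A i} = (\<Prod>i\<in>UNIV. emeasure (distr (ends_law n) borel g) (A i))"
    by simp
qed simp

section \<open>The limit theorem for the cube\<close>

lemma nth_image_cbox:
  fixes a b :: "real^'d"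
  assumes "\<And>j. a $ j \<le> b $ j"
  shows "(\<lambda>x. x $ i) ` cbox a b = {a $ i..b $ i}"
proof
  show "{a $ i..b $ i} \<subseteq> (\<lambda>x. x $ i) ` cbox a b"
  proof
    fix y assume y: "y \<in> {a $ i..b $ i}"
    \<comment> \<open>Only coordinate i moves; the others stay at the lower corner.\<close>
    then have "(\<chi> j. if j = i then y else a $ j) \<in> cbox a b"
      using assms by (auto simp: mem_box_cart)
    then show "y \<in> (\<lambda>x. x $ i) ` cbox a b" by (rule rev_image_eqI) simp
  qed
qed (auto simp: mem_box_cart)

lemma cbox_eq_empty_vec:
  fixes a b :: "real^'d"
  shows "cbox a b = {} \<longleftrightarrow> \<not> (\<forall>j. a $ j \<le> b $ j)"
  by (auto simp: interval_eq_empty_cart not_le)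

text \<open>The else branches are junk values at sequences with empty body, which have probability zero; they matter only for measurability.\<close>

lemma edge_len_cube_body:
  "edge_len (dim_body cube cube n ps) i =
    (if \<forall>j. fst (ends_at n ps j) \<le> snd (ends_at n ps j) then excess (ends_at n ps i) + 1 else Sup {} - Inf {})"
  by (auto simp: edge_len_def dim_body_cube nth_image_cbox cbox_eq_empty_vec[THEN iffD2] excess_def)

lemma centre_coord_cube_body:
  "centre_coord (dim_body cube cube n ps) i =
    (if \<forall>j. fst (ends_at n ps j) \<le> snd (ends_at n ps j) then centre (ends_at n ps i) else (Sup {} + Inf {}) / 2)"
  by (auto simp: centre_coord_def dim_body_cube nth_image_cbox cbox_eq_empty_vec[THEN iffD2] centre_def)

lemma borel_measurable_edge_len [measurable]:
  "(\<lambda>ps. edge_len (dim_body (cube :: (real^'d) set) cube n ps) i) \<in> borel_measurable (dim_law cube cube n)"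
  and borel_measurable_centre_coord [measurable]:
  "(\<lambda>ps. centre_coord (dim_body (cube :: (real^'d) set) cube n ps) i) \<in> borel_measurable (dim_law cube cube n)"
  unfolding edge_len_cube_body centre_coord_cube_body by measurable

lemma edge_vec_law:
  "distr (dim_law (cube :: (real^'d) set) cube n) borel
      (\<lambda>ps. \<chi> i. 2 * real n * (edge_len (dim_body cube cube n ps) i - 1)) =
    distr (PiM UNIV (\<lambda>_. distr (ends_law n) borel (\<lambda>e. 2 * real n * excess e))) borel (\<lambda>\<omega>. \<chi> i. \<omega> i)"
proof -
  have "distr (dim_law (cube :: (real^'d) set) cube n) borel
      (\<lambda>ps. \<chi> i. 2 * real n * (edge_len (dim_body cube cube n ps) i - 1)) =
    distr (dim_law (cube :: (real^'d) set) cube n) borel (\<lambda>ps. \<chi> i. 2 * real n * excess (ends_at n ps i))"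
  proof (rule distr_cong_AE)
    show "AE ps in dim_law (cube :: (real^'d) set) cube n.
      (\<chi> i. 2 * real n * (edge_len (dim_body cube cube n ps) i - 1)) = (\<chi> i. 2 * real n * excess (ends_at n ps i))"
      using AE_cube_law_admissible
    proof eventually_elim
      case (elim ps)
      then have "\<forall>j. fst (ends_at n ps j) \<le> snd (ends_at n ps j)"
        unfolding admissible_def by (smt (verit))
      then show ?case by (simp add: edge_len_cube_body)
    qed
  qed (simp_all add: borel_measurable_vecI)
  also have "\<dots> = distr (PiM UNIV (\<lambda>_. distr (ends_law n) borel (\<lambda>e. 2 * real n * excess e))) borel (\<lambda>\<omega>. \<chi> i. \<omega> i)"
    by (rule cube_law_vec_law) measurable
  finally show ?thesis .
qed

lemma centre_vec_law:
  "distr (dim_law (cube :: (real^'d) set) cube n) borel (\<lambda>ps. \<chi> i. centre_coord (dim_body cube cube n ps) i) =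
    distr (PiM UNIV (\<lambda>_. distr (ends_law n) borel centre)) borel (\<lambda>\<omega>. \<chi> i. \<omega> i)"
proof -
  have "distr (dim_law (cube :: (real^'d) set) cube n) borel (\<lambda>ps. \<chi> i. centre_coord (dim_body cube cube n ps) i) =
    distr (dim_law (cube :: (real^'d) set) cube n) borel (\<lambda>ps. \<chi> i. centre (ends_at n ps i))"
  proof (rule distr_cong_AE)
    show "AE ps in dim_law (cube :: (real^'d) set) cube n.
      (\<chi> i. centre_coord (dim_body cube cube n ps) i) = (\<chi> i. centre (ends_at n ps i))"
      using AE_cube_law_admissible
    proof eventually_elim
      case (elim ps)
      then have "\<forall>j. fst (ends_at n ps j) \<le> snd (ends_at n ps j)"
        unfolding admissible_def by (smt (verit))
      then show ?case by (simp add: centre_coord_cube_body)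
    qed
  qed (simp_all add: borel_measurable_vecI)
  then show ?thesis by (simp add: cube_law_vec_law)
qed

text \<open>Nondecreasing maps commute with maxima. The case c = 0 is included because c = 2n
  vanishes at n = 0.\<close>

lemma Max_affine:
  fixes f :: "'d::finite \<Rightarrow> real"
  assumes "0 \<le> c"
  shows "Max (range (\<lambda>i. c * (f i - 1))) = c * (Max (range f) - 1)"
proof -
  have "mono (\<lambda>x. c * (x - 1))" using assms by (auto intro!: monoI mult_left_mono)
  from mono_Max_commute[OF this, of "range f"] show ?thesis by (simp add: image_image)
qed

lemma max_edge_law:
  "distr (dim_law (cube :: (real^'d) set) cube n) borel
      (\<lambda>ps. 2 * real n * (Max (range (edge_len (dim_body cube cube n ps))) - 1)) =
    distr (distr (PiM UNIV (\<lambda>_. distr (ends_law n) borel (\<lambda>e. 2 * real n * excess e))) borel (\<lambda>\<omega>. \<chi> i. \<omega> i))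
      borel (\<lambda>x :: real^'d. Max (range (($) x)))"
proof -
  have m: "(\<lambda>ps. \<chi> i. 2 * real n * (edge_len (dim_body cube cube n ps) i - 1))
      \<in> dim_law (cube :: (real^'d) set) cube n \<rightarrow>\<^sub>M borel"
    by (simp add: borel_measurable_vecI)
  have max: "(\<lambda>x :: real^'d. Max (range (($) x))) \<in> borel_measurable borel"
    by (rule borel_measurable_Max) simp_all
  show ?thesis
    unfolding edge_vec_law[symmetric] distr_distr[OF max m]
    by (simp add: comp_def Max_affine)
qed

lemma real_distribution_exponential: "real_distribution (density lborel (exponential_density 1))"
  using prob_space_exponential_density[of 1] by (simp add: real_distribution_def real_distribution_axioms_def)

lemma cdf_exponential: "cdf (density lborel (exponential_density 1)) t = (if 0 \<le> t then 1 - exp (- t) else 0)"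
  by (simp add: cdf_def measure_def emeasure_erlang_density erlang_CDF_0)

lemma real_distribution_ends_law:
  "g \<in> borel_measurable borel \<Longrightarrow> real_distribution (distr (ends_law n) borel g)"
  by (rule prob_space.real_distribution_distr[OF prob_space_ends_law]) simp

lemma excess_cdf_limit:
  "(\<lambda>n. cdf (distr (ends_law n) borel (\<lambda>e. 2 * real n * excess e)) t) \<longlonglongrightarrow>
    cdf (density lborel (exponential_density 1)) t"
proof -
  have cdf: "cdf (distr (ends_law n) borel (\<lambda>e. 2 * real n * excess e)) t =
      measure (ends_law n) {e. 2 * real n * excess e \<le> t}" for n
    unfolding cdf_def by (subst measure_distr) (simp_all add: vimage_def)
  show ?thesis
  proof (cases "0 \<le> t")
    case True
    have eq: "measure (ends_law n) {e. 2 * real n * excess e \<le> t} = 1 - excess_tail n (t / (2 * real n))"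
      if "0 < n" for n
    proof -
      interpret prob_space "ends_law n" by (rule prob_space_ends_law)
      have "{e. 2 * real n * excess e \<le> t} = space (ends_law n) - {e. t / (2 * real n) < excess e}"
        using that by (auto simp: field_simps)
      then show ?thesis unfolding excess_tail_def by (simp only:) (rule prob_compl, simp)
    qed
    have "(\<lambda>n. 1 - excess_tail n (t / (2 * real n))) \<longlonglongrightarrow> 1 - exp (- t)"
      by (intro tendsto_intros excess_tail_limit True)
    then show ?thesis
    proof (rule Lim_transform_eventually[THEN tendsto_eq_rhs])
      show "eventually (\<lambda>n. 1 - excess_tail n (t / (2 * real n)) =
          cdf (distr (ends_law n) borel (\<lambda>e. 2 * real n * excess e)) t) sequentially"
        using eventually_gt_at_top[of 0] by eventually_elim (simp add: cdf eq)
    qed (simp add: cdf_exponential True)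
  next
    case False
    have "measure (ends_law n) {e. 2 * real n * excess e \<le> t} = 0" for n
    proof -
      have "AE e in ends_law n. \<not> 2 * real n * excess e \<le> t"
        using AE_ends_law_admissible
      proof eventually_elim
        case (elim e)
        then have "0 \<le> 2 * real n * excess e" using excess_admissible[OF elim] by simp
        then show ?case using False by linarith
      qed
      then have "emeasure (ends_law n) {e. 2 * real n * excess e \<le> t} = 0"
        by (subst (asm) AE_iff_measurable[OF _ refl]) simp_all
      then show ?thesis by (simp add: measure_def)
    qed
    then show ?thesis by (simp add: cdf cdf_exponential False)
  qed
qed

lemma excess_weak_conv:
  "weak_conv_m (\<lambda>n. distr (ends_law n) borel (\<lambda>e. 2 * real n * excess e)) (density lborel (exponential_density 1))"
  unfolding weak_conv_m_def weak_conv_def using excess_cdf_limit by blast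

lemma centre_weak_conv:
  "weak_conv_m (\<lambda>n. distr (ends_law n) borel centre) (density lborel arcsine_half_density)"
proof -
  have "cdf (distr (ends_law n) borel centre) t = measure (ends_law n) {e. centre e \<le> t}" for n t
    unfolding cdf_def by (subst measure_distr) (simp_all add: vimage_def)
  then show ?thesis
    unfolding weak_conv_m_def weak_conv_def by (simp add: cdf_arcsine_law centre_cdf_limit)
qed

theorem theorem3:
  fixes d_type :: "'d::finite itself"
  shows
   "(\<forall>n ps. \<exists>a b. dim_body (cube::(real^'d) set) cube n ps = cbox a b) \<and>
    conv_distr
      (\<lambda>n. distr (dim_law (cube::(real^'d) set) cube n) borel
             (\<lambda>ps. \<chi> i. 2 * real n * (edge_len (dim_body cube cube n ps) i - 1)))
      (density lborel (\<lambda>x::real^'d. \<Prod>i\<in>UNIV. exponential_density 1 (x $ i))) \<and>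
    (\<exists>W. real_distribution W \<and>
         (\<forall>x. cdf W x = (if 0 \<le> x then (1 - exp (- x)) ^ CARD('d) else 0)) \<and>
         weak_conv_m
           (\<lambda>n. distr (dim_law (cube::(real^'d) set) cube n) borel
                  (\<lambda>ps. 2 * real n *
                        (Max (range (edge_len (dim_body cube cube n ps))) - 1)))
           W) \<and>
    conv_distr
      (\<lambda>n. distr (dim_law (cube::(real^'d) set) cube n) borel
             (\<lambda>ps. \<chi> i. centre_coord (dim_body cube cube n ps) i))
      (density lborel (\<lambda>x::real^'d. \<Prod>i\<in>UNIV. arcsine_half_density (x $ i)))"
proof (intro conjI)
  show "\<forall>n ps. \<exists>a b. dim_body (cube::(real^'d) set) cube n ps = cbox a b"
    using dim_body_cube by blast
  let ?E = "density lborel (exponential_density 1)"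
  have exp_vec: "density lborel (\<lambda>x::real^'d. \<Prod>i\<in>UNIV. exponential_density 1 (x $ i)) =
      distr (PiM UNIV (\<lambda>_. ?E)) borel (\<lambda>\<omega>. \<chi> i. \<omega> i)"
    by (rule density_vec_law) (simp_all add: real_distribution_exponential exponential_density_nonneg)
  show "conv_distr
      (\<lambda>n. distr (dim_law (cube::(real^'d) set) cube n) borel
             (\<lambda>ps. \<chi> i. 2 * real n * (edge_len (dim_body cube cube n ps) i - 1)))
      (density lborel (\<lambda>x::real^'d. \<Prod>i\<in>UNIV. exponential_density 1 (x $ i)))"
    unfolding edge_vec_law exp_vec
    by (rule conv_distr_vec_law[OF _ real_distribution_exponential excess_weak_conv])
       (simp add: real_distribution_ends_law)
  have arc_vec: "density lborel (\<lambda>x::real^'d. \<Prod>i\<in>UNIV. arcsine_half_density (x $ i)) =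
      distr (PiM UNIV (\<lambda>_. density lborel arcsine_half_density)) borel (\<lambda>\<omega>. \<chi> i. \<omega> i)"
    by (rule density_vec_law) (simp_all add: real_distribution_arcsine_law arcsine_half_density_nonneg)
  show "conv_distr
      (\<lambda>n. distr (dim_law (cube::(real^'d) set) cube n) borel
             (\<lambda>ps. \<chi> i. centre_coord (dim_body cube cube n ps) i))
      (density lborel (\<lambda>x::real^'d. \<Prod>i\<in>UNIV. arcsine_half_density (x $ i)))"
    unfolding centre_vec_law arc_vec
    by (rule conv_distr_vec_law[OF _ real_distribution_arcsine_law centre_weak_conv])
       (simp add: real_distribution_ends_law)
  \<comment> \<open>The law of the largest of \<open>CARD('d)\<close> independent standard
    exponential variables.\<close>
  let ?W = "distr (distr (PiM UNIV (\<lambda>_. ?E)) borel (\<lambda>\<omega>. \<chi> i. \<omega> i)) borel (\<lambda>x :: real^'d. Max (range (($) x)))"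
  show "\<exists>W. real_distribution W \<and>
         (\<forall>x. cdf W x = (if 0 \<le> x then (1 - exp (- x)) ^ CARD('d) else 0)) \<and>
         weak_conv_m
           (\<lambda>n. distr (dim_law (cube::(real^'d) set) cube n) borel
                  (\<lambda>ps. 2 * real n *
                        (Max (range (edge_len (dim_body cube cube n ps))) - 1)))
           W"
  proof (intro exI[of _ ?W] conjI allI)
    interpret E: real_distribution ?E by (rule real_distribution_exponential)
    interpret product_prob_space "\<lambda>_::'d. ?E" UNIV ..
    have vec: "(\<lambda>\<omega>. \<chi> i. \<omega> i) \<in> PiM (UNIV :: 'd set) (\<lambda>_. ?E) \<rightarrow>\<^sub>M borel"
      by (rule measurable_vec_lambda_PiM) simp
    have max: "(\<lambda>x :: real^'d. Max (range (($) x))) \<in> borel_measurable borel"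
      by (rule borel_measurable_Max) simp_all
    show "real_distribution ?W"
      by (rule prob_space.real_distribution_distr[OF P.prob_space_distr[OF vec]]) (use max in simp)
    show "cdf ?W x = (if 0 \<le> x then (1 - exp (- x)) ^ CARD('d) else 0)" for x
      by (simp add: cdf_max_vec_law[OF real_distribution_exponential] cdf_exponential)
    show "weak_conv_m (\<lambda>n. distr (dim_law (cube::(real^'d) set) cube n) borel
                  (\<lambda>ps. 2 * real n * (Max (range (edge_len (dim_body cube cube n ps))) - 1))) ?W"
      \<comment> \<open>Both distribution functions are powers of one-dimensional ones, so
        \<open>excess_cdf_limit\<close> gives convergence at every point.\<close>
      unfolding weak_conv_m_def weak_conv_def max_edge_law
      by (auto simp: cdf_max_vec_law real_distribution_exponential real_distribution_ends_law
          intro!: tendsto_power excess_cdf_limit)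
  qed
qed

end
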